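(* Let $\mathcal{M}$ be a moon polyomino with $m$ columns, $\mathbf{s}$ an $m$-tuple of nonnegative integers, $A$ a subset of the rows of $\mathcal{M}$, and let $\mathcal{N}$, $\mathbf{s}'$ and $f$ be as defined in the context. The map $f:\mathbf{F}(\mathcal{M},\mathbf{s};A)\to\mathbf{F}(\mathcal{N},\mathbf{s}';A)$ is a bijection and $\mathrm{maj}(M)=\mathrm{maj}(f(M))$ for every $M\in\mathbf{F}(\mathcal{M},\mathbf{s};A)$.
   Context: **Polyominoes.** A polyomino is a finite subset of $\mathbb{Z}^2$ whose elements are drawn as square cells. It is convex if its intersection with any row or column is connected, and intersection-free if any two of its columns are comparable, i.e. the set of row-coordinates of one is contained in that of the other. A moon polyomino is a convex intersection-free polyomino. A moon polyomino whose rows are left-aligned is a left-aligned stack polyomino. Columns are labelled $c_1,\dots,c_m$ from left to right. **Fillings.** A filling of a moon polyomino $\mathcal{M}$ assigns $0$ or $1$ to each cell with at most one $1$ in each row; a 1-cell is a cell assigned $1$; a row is empty if it contains no 1-cell. $\mathbf{F}(\mathcal{M},\mathbf{s};A)$ is the set of fillings of $\mathcal{M}$ whose empty rows are exactly those in $A$ and in which column $c_i$ has exactly $s_i$ 1's for each $i$. An NE chain is a pair of 1-cells, one strictly above and strictly to the right of the other, such that the smallest rectangle containing them is contained in $\mathcal{M}$. **Major index.** For a filling $R$ of a rectangle with nonempty rows $r_1,\dots,r_n$ from top to bottom, $\mathrm{des}(R)$ is the number of $i$ such that the 1-cells of $r_i$ and $r_{i+1}$ form an NE chain; $R(r_i)$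 is the restriction of $R$ to the row $r_i$ and all rows above it; $\mathrm{maj}(R)=\sum_{i=1}^n\mathrm{des}(R(r_i))$. For a filling $M$ of a moon polyomino $\mathcal{M}$, let $\mathcal{R}_1,\dots,\mathcal{R}_r$ be all the maximal rectangles contained in $\mathcal{M}$, ordered increasingly by height, and $R_i$ the restriction of $M$ to $\mathcal{R}_i$. Then $\mathrm{maj}(M)=\sum_{i=1}^r\mathrm{maj}(R_i)-\sum_{i=1}^{r-1}\mathrm{maj}(R_i\cap R_{i+1})$. **Algorithm $\alpha$.** Set $\mathcal{M}'=\mathcal{M}$. While $\mathcal{M}'$ is not left-aligned, let $\mathcal{R}$ be the largest rectangle contained in $\mathcal{M}'$ that contains the leftmost column of $\mathcal{M}'$, and replace $\mathcal{M}'$ by the polyomino obtained by moving this leftmost column (keeping its row-coordinates) to the right end of $\mathcal{R}$. The final $\mathcal{M}'$ is $\mathcal{N}$, the left-aligned stack polyomino with the same row lengths as $\mathcal{M}$ from top to bottom. $\mathbf{s}'$ is $\mathbf{s}$ rearranged in the same way as the columns. **The transformation $\tau$ on a filling $R$ of a rectangle.** Let the 1-cells of the first column be $C_1,\dots,C_k$ from top to bottom. An ascent is a pair of 1's in two consecutive nonempty rows that does not form an NE chain; a descent is such a pair that forms an NE chain. (1) Let $R^*$ be $R$ with one empty column added on the right. (2) For $r=k,k-1,\dots,1$: let $D_a$ be the lowest 1-cell above $C_r$ in $R^*$ and $D_b$ the highest 1-cell below $C_r$ in $R^*$. (a) If $D_a$ does not exist or $D_a=C_{r-1}$, and $D_b$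 does not exist, move $C_r$ horizontally to the last column of $R^*$. (b) If ($D_a$ does not exist or $D_a=C_{r-1}$, but $D_b$ exists), or (both exist and $D_a$ is strictly to the right of $D_b$): let $D_1=C_r,D_2=D_b,D_3,\dots,D_p$ be the maximal chain of consecutive ascents in $R^*$ going down from $C_r$; move $D_i$ horizontally to the column of $D_{i+1}$ for $i=1,\dots,p-1$, and $D_p$ horizontally to the last column of $R^*$ (it stays if already there). (c) If $D_a$ exists, $D_a\neq C_{r-1}$, and ($D_a$ is weakly to the left of $D_b$ or $D_b$ does not exist): let $D_1=C_r,D_2=D_a,D_3,\dots,D_p$ be the maximal chain of consecutive descents in $R^*$ going up from $C_r$; move $D_i$ horizontally to the column of $D_{i+1}$ for $i=1,\dots,p-1$, and $D_p$ horizontally to the last column of $R^*$. (3) Delete the first column of $R^*$. **The map $f$.** Perform $\alpha$ on $\mathcal{M}$ together with the filling $M$; at each step, replace the filling $R$ of $\mathcal{R}$ by $\tau(R)$ on the rectangle obtained after moving the column, leaving 1's outside $\mathcal{R}$ in their rows and in their (moved) columns. $f(M)$ is the resulting filling of $\mathcal{N}$. *)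

theory Defs
  imports Main "HOL-Library.While_Combinator"
begin

text \<open>
  Cells carry matrix coordinates: \<open>(i, j)\<close> lies in row \<open>i\<close>, rows being numbered downwards,
  and in column \<open>j\<close>, columns being numbered from left to right.
\<close>

type_synonym cell = "int \<times> int"

definition rows :: "cell set \<Rightarrow> int set" where
  "rows P = fst ` P"

definition cols :: "cell set \<Rightarrow> int set" where
  "cols P = snd ` P"

definition row_of :: "cell set \<Rightarrow> int \<Rightarrow> int set" where
  "row_of P i = {j. (i, j) \<in> P}"

definition col_of :: "cell set \<Rightarrow> int \<Rightarrow> int set" where
  "col_of P j = {i. (i, j) \<in> P}"

definition connected_int :: "int set \<Rightarrow> bool" where
  "connected_int S \<longleftrightarrow> (\<forall>a\<in>S. \<forall>b\<in>S. {a..b} \<subseteq> S)"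

definition convex_polyomino :: "cell set \<Rightarrow> bool" where
  "convex_polyomino P \<longleftrightarrow>
     (\<forall>i. connected_int (row_of P i)) \<and> (\<forall>j. connected_int (col_of P j))"

definition intersection_free :: "cell set \<Rightarrow> bool" where
  "intersection_free P \<longleftrightarrow>
     (\<forall>j\<in>cols P. \<forall>j'\<in>cols P. col_of P j \<subseteq> col_of P j' \<or> col_of P j' \<subseteq> col_of P j)"

definition moon_polyomino :: "cell set \<Rightarrow> bool" where
  "moon_polyomino P \<longleftrightarrow> finite P \<and> convex_polyomino P \<and> intersection_free P"

definition left_aligned :: "cell set \<Rightarrow> bool" where
  "left_aligned P \<longleftrightarrow> (\<forall>i\<in>rows P. (i, Min (cols P)) \<in> P)"

definition rectangle :: "cell set \<Rightarrow> bool" where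
  "rectangle R \<longleftrightarrow> (\<exists>i i' j j'. i \<le> i' \<and> j \<le> j' \<and> R = {i..i'} \<times> {j..j'})"

text \<open>
  A filling is represented by its set of 1-cells.  The list \<open>s\<close> prescribes the number of 1-cells
  in the (nonempty) columns of \<open>P\<close>, read from left to right.
\<close>

definition filling :: "cell set \<Rightarrow> cell set \<Rightarrow> bool" where
  "filling P M \<longleftrightarrow> M \<subseteq> P \<and> (\<forall>i j j'. (i, j) \<in> M \<longrightarrow> (i, j') \<in> M \<longrightarrow> j = j')"

definition fillings :: "cell set \<Rightarrow> nat list \<Rightarrow> int set \<Rightarrow> cell set set" where
  "fillings P s A =
     {M. filling P M \<and>
         {i \<in> rows P. row_of M i = {}} = A \<and>
         (\<forall>k<card (cols P). card (col_of M (sorted_list_of_set (cols P) ! k)) = s ! k)}"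

text \<open>The first argument cell is the upper right one of the chain.\<close>

definition NE_chain :: "cell set \<Rightarrow> cell \<Rightarrow> cell \<Rightarrow> bool" where
  "NE_chain P c d \<longleftrightarrow>
     fst c < fst d \<and> snd d < snd c \<and> {fst c..fst d} \<times> {snd d..snd c} \<subseteq> P"

text \<open>
  The 1-cells from top to bottom.  The sorting key is injective on the 1-cells because a filling
  has at most one 1-cell in each row.
\<close>

definition ones :: "cell set \<Rightarrow> cell list" where
  "ones T = sorted_key_list_of_set fst T"

definition des :: "cell set \<Rightarrow> cell set \<Rightarrow> nat" where
  "des R T = card {k. Suc k < length (ones T) \<and> NE_chain R (ones T ! k) (ones T ! Suc k)}"

definition down_to :: "int \<Rightarrow> cell set \<Rightarrow> cell set" where
  "down_to i T = {c \<in> T. fst c \<le> i}"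

text \<open>The nonempty rows of the filling \<open>T\<close> are exactly those in \<open>rows T\<close>.\<close>

definition maj_rect :: "cell set \<Rightarrow> cell set \<Rightarrow> nat" where
  "maj_rect R T = (\<Sum>i\<in>rows T. des (down_to i R) (down_to i T))"

definition maximal_rectangles :: "cell set \<Rightarrow> cell set set" where
  "maximal_rectangles P =
     {R. rectangle R \<and> R \<subseteq> P \<and> (\<forall>R'. rectangle R' \<longrightarrow> R' \<subseteq> P \<longrightarrow> R \<subseteq> R' \<longrightarrow> R' = R)}"

text \<open>Distinct maximal rectangles of a moon polyomino have distinct heights.\<close>

definition rect_list :: "cell set \<Rightarrow> cell set list" where
  "rect_list P = sorted_key_list_of_set (\<lambda>R. card (rows R)) (maximal_rectangles P)"

definition maj :: "cell set \<Rightarrow> cell set \<Rightarrow> int" where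
  "maj P M =
     (let Rs = rect_list P; r = length Rs in
       (\<Sum>k<r. int (maj_rect (Rs ! k) (M \<inter> Rs ! k))) -
       (\<Sum>k<r - 1. int (maj_rect (Rs ! k \<inter> Rs ! Suc k) (M \<inter> (Rs ! k \<inter> Rs ! Suc k)))))"

text \<open>\<open>GREATEST\<close> refers to inclusion.\<close>

definition left_rectangle :: "cell set \<Rightarrow> cell set" where
  "left_rectangle P =
     (GREATEST R. rectangle R \<and> R \<subseteq> P \<and> {c \<in> P. snd c = Min (cols P)} \<subseteq> R)"

text \<open>
  Moving the leftmost column to the right end of a rectangle \<open>R\<close> that starts in the leftmost
  column: the other columns meeting \<open>R\<close> shift one position to the left, all columns to the right
  of \<open>R\<close> keep their position.  The rectangle itself is thereby mapped onto itself.
\<close>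

definition move_col :: "cell set \<Rightarrow> cell \<Rightarrow> cell" where
  "move_col R c =
     (let a = Min (cols R); b = Max (cols R); (i, j) = c in
       (i, if j = a then b else if a < j \<and> j \<le> b then j - 1 else j))"

definition alpha_step :: "cell set \<times> nat list \<Rightarrow> cell set \<times> nat list" where
  "alpha_step = (\<lambda>(P, s).
     let R = left_rectangle P; w = card (cols R)
     in (move_col R ` P, rotate1 (take w s) @ drop w s))"

definition alpha :: "cell set \<times> nat list \<Rightarrow> cell set \<times> nat list" where
  "alpha = while (\<lambda>(P, s). \<not> left_aligned P) alpha_step"

text \<open>The longest initial segment of a list in which consecutive entries are related.\<close>

fun initial_run :: "('a \<Rightarrow> 'a \<Rightarrow> bool) \<Rightarrow> 'a list \<Rightarrow> 'a list" where
  "initial_run Q [] = []"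
| "initial_run Q [x] = [x]"
| "initial_run Q (x # y # zs) = (if Q x y then x # initial_run Q (y # zs) else [x])"

text \<open>
  Move each cell of \<open>Ds\<close> horizontally to the column of its successor in \<open>Ds\<close>, and the last one
  to column \<open>l\<close>.
\<close>

definition shift_cells :: "int \<Rightarrow> cell list \<Rightarrow> cell set \<Rightarrow> cell set" where
  "shift_cells l Ds T =
     (T - set Ds) \<union> set (zip (map fst Ds) (map snd (tl Ds) @ [l]))"

text \<open>
  One iteration of the loop in \<open>\<tau>\<close>.  Here \<open>S\<close> is the rectangle extended by a column \<open>l\<close> on the
  right, \<open>T\<close> its current filling, and \<open>Cs\<close> lists the 1-cells of the first column
  of the initial filling from top to bottom; indices start at 0.  The heads of \<open>up\<close> and \<open>dn\<close>,
  if present, are \<open>D\<^sub>a\<close> and \<open>D\<^sub>b\<close>.  The final \<open>else\<close> is exactly case (c): \<open>D\<^sub>a\<close> exists, it is not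
  the cell preceding \<open>c\<close> in \<open>Cs\<close>, and it lies weakly to the left of \<open>D\<^sub>b\<close> unless the
  latter does not exist.
\<close>

definition tau_step :: "cell set \<Rightarrow> int \<Rightarrow> cell list \<Rightarrow> nat \<Rightarrow> cell set \<Rightarrow> cell set" where
  "tau_step S l Cs r T =
     (let c = Cs ! r;
          up = rev (filter (\<lambda>d. fst d < fst c) (ones T));
          dn = filter (\<lambda>d. fst c < fst d) (ones T);
          no_Da = (up = [] \<or> (0 < r \<and> hd up = Cs ! (r - 1)))
      in if no_Da \<and> dn = [] then shift_cells l [c] T
         else if (no_Da \<and> dn \<noteq> []) \<or> (up \<noteq> [] \<and> dn \<noteq> [] \<and> snd (hd dn) < snd (hd up))
         then shift_cells l (initial_run (\<lambda>d d'. \<not> NE_chain S d d') (c # dn)) T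
         else shift_cells l (initial_run (\<lambda>d d'. NE_chain S d' d) (c # up)) T)"

text \<open>
  After its first column \<open>a\<close> has been deleted, the extended rectangle is shifted one position to
  the left, so that \<open>\<tau>\<close> produces a filling of the same set of cells \<open>R\<close>.
\<close>

definition tau :: "cell set \<Rightarrow> cell set \<Rightarrow> cell set" where
  "tau R T =
     (let a = Min (cols R);
          l = Max (cols R) + 1;
          S = R \<union> rows R \<times> {l};
          Cs = ones {c \<in> T. snd c = a};
          T' = fold (tau_step S l Cs) (rev [0..<length Cs]) T
      in (\<lambda>(i, j). (i, j - 1)) ` {c \<in> T'. snd c \<noteq> a})"

definition f_step :: "cell set \<times> cell set \<Rightarrow> cell set \<times> cell set" where
  "f_step = (\<lambda>(P, M).
     let R = left_rectangle P
     in (move_col R ` P, move_col R ` (M - R) \<union> tau R (M \<inter> R)))"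

definition f_map :: "cell set \<Rightarrow> cell set \<Rightarrow> cell set" where
  "f_map P M = snd (while (\<lambda>(P, M). \<not> left_aligned P) f_step (P, M))"

end

(*
  Read the columns of the 1-cells of a rectangle from top to bottom as a word. One pass of the loop
  in tau deletes the lowest letter a (the first column) from this word and inserts the letter l (the
  added column) at the end of the maximal weakly increasing run below it, or of the maximal strictly
  increasing run above it. Hence tau keeps the order of all other letters, and the case distinction
  is made exactly such that the positions of the descents do not change and such that the pass can
  be undone at the topmost l.

  Let H x [a..b] be the rectangle of a step of alpha. Every maximal rectangle, and every intersection
  of two consecutive ones, has either only rows of H and at least the columns a..b, or all rows of H
  and only columns in a+1..b. In the first case the descents between consecutive nonempty rows are
  preserved; in the second case the word itself is preserved up to the shift of the columns. So each
  summand of maj is preserved. Since tau is injective, and permuting the columns alone is already a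
  bijection between the fillings before and after the step, each step is bijective.
*)

theory Submission
  imports Defs
begin

section \<open>Words and the major index of a rectangle\<close>

text \<open>Positions in a word are too coarse for the boxes with only rows of \<open>H\<close>:
  such a box may miss some rows of \<open>H\<close> and may contain further 1-cells to the right of
  column \<open>b\<close>. Descents are therefore also recorded as pairs of rows
  (\<open>des_rows\<close>). These can be localised to an interval of rows, and a cell to the right
  of \<open>b\<close> compares with a cell of the left rectangle in the same way whatever column
  within \<open>a..b\<close> the latter has. Undoing a pass requires deciding in which direction it
  went; the letters next to the most recently inserted \<open>l\<close> reveal this. The number of
  passes to undo is the prescribed number of 1's in column \<open>a\<close>. Words forget the rows,
  but \<open>tau\<close> changes no row, so a filling is recovered from its word and its set of
  nonempty rows. The iteration ends because a row that does not start in the leftmost column moves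
  left in every step.\<close>

lemma (in linorder) sorted_key_list_of_set_eqI:
  fixes f :: "'b \<Rightarrow> 'a"
  assumes "sorted_wrt (<) (map f xs)" and "set xs = A"
  shows "sorted_key_list_of_set f A = xs"
proof -
  have "distinct (map f xs)"
    using assms(1) by (simp add: strict_sorted_iff)
  then have inj: "inj_on f A"
    using assms(2) by (auto simp: distinct_map)
  interpret folding_insort_key "(\<le>)" "(<)" A f
    by standard (rule inj)
  show ?thesis
    using idem_if_sorted_distinct[of xs] assms \<open>distinct (map f xs)\<close>
    by (auto simp: strict_sorted_iff distinct_map)
qed

lemma (in linorder) sorted_key_list_of_set_properties:
  fixes f :: "'b \<Rightarrow> 'a"
  assumes "finite A" and "inj_on f A"
  shows "set (sorted_key_list_of_set f A) = A"
    and "sorted_wrt (<) (map f (sorted_key_list_of_set f A))"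
proof -
  interpret folding_insort_key "(\<le>)" "(<)" A f
    by standard (rule assms(2))
  show "set (sorted_key_list_of_set f A) = A"
    using assms(1) by simp
  show "sorted_wrt (<) (map f (sorted_key_list_of_set f A))"
    by simp
qed

text \<open>What remains of a filling when the surrounding polyomino is forgotten. Restrictions and
  images under \<open>tau\<close> inherit it, so words can be handled without reference to
  \<open>P\<close>.\<close>

definition row_filling :: "cell set \<Rightarrow> bool" where
  "row_filling T \<longleftrightarrow> finite T \<and> inj_on fst T"

definition word :: "cell set \<Rightarrow> int list" where
  "word T = map snd (ones T)"

lemma row_filling_subset: "row_filling T \<Longrightarrow> U \<subseteq> T \<Longrightarrow> row_filling U"
  by (auto simp: row_filling_def intro: finite_subset inj_on_subset)

lemma row_filling_unique: "row_filling T \<Longrightarrow> (i, j) \<in> T \<Longrightarrow> (i, j') \<in> T \<Longrightarrow> j = j'"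
  unfolding row_filling_def by (metis fst_conv inj_onD prod.inject)

lemma filling_row_filling: "finite P \<Longrightarrow> filling P M \<Longrightarrow> row_filling M"
  by (auto simp: row_filling_def filling_def inj_on_def intro: finite_subset)

lemma ones_eqI: "sorted_wrt (<) (map fst xs) \<Longrightarrow> set xs = T \<Longrightarrow> ones T = xs"
  unfolding ones_def by (rule sorted_key_list_of_set_eqI)

lemma set_ones: "row_filling T \<Longrightarrow> set (ones T) = T"
  by (simp add: ones_def row_filling_def sorted_key_list_of_set_properties)

lemma sorted_ones: "row_filling T \<Longrightarrow> sorted_wrt (<) (map fst (ones T))"
  by (simp add: ones_def row_filling_def sorted_key_list_of_set_properties)

lemma ones_nth_less_iff:
  assumes "row_filling T" "m < length (ones T)" "k < length (ones T)"
  shows "fst (ones T ! m) < fst (ones T ! k) \<longleftrightarrow> m < k"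
proof -
  have *: "fst (ones T ! p) < fst (ones T ! q)" if "p < q" "q < length (ones T)" for p q
    using sorted_wrt_nth_less[OF sorted_ones[OF assms(1)] that(1)] that by simp
  show ?thesis
    using *[of m k] *[of k m] assms by (cases m k rule: linorder_cases) auto
qed

lemma map_fst_ones: "row_filling T \<Longrightarrow> map fst (ones T) = sorted_list_of_set (rows T)"
  by (metis set_ones sorted_ones list.set_map rows_def strict_sorted_equal
      row_filling_def finite_imageI sorted_list_of_set.set_sorted_key_list_of_set subset_UNIV
      sorted_list_of_set.strict_sorted_key_list_of_set)

lemma ones_append:
  assumes "row_filling T" "row_filling U" and "\<And>c d. c \<in> T \<Longrightarrow> d \<in> U \<Longrightarrow> fst c < fst d"
  shows "ones (T \<union> U) = ones T @ ones U"
  using assms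
  by (intro ones_eqI) (auto simp: sorted_wrt_append sorted_ones set_ones)

lemma ones_filter: "row_filling T \<Longrightarrow> ones {c \<in> T. Q c} = filter Q (ones T)"
  by (intro ones_eqI) (use sorted_ones[of T] in \<open>auto simp: set_ones sorted_wrt_map sorted_wrt_filter\<close>)

lemma ones_zip:
  assumes "sorted_wrt (<) rs" "length rs = length w"
  shows "ones (set (zip rs w)) = zip rs w" and "row_filling (set (zip rs w))"
proof -
  have "distinct (map fst (zip rs w))"
    using assms by (simp add: strict_sorted_iff)
  then show "row_filling (set (zip rs w))"
    unfolding distinct_map row_filling_def by auto
  show "ones (set (zip rs w)) = zip rs w"
    by (rule ones_eqI) (use assms in auto)
qed

lemma rows_eq_nth:
  assumes "row_filling T" "i \<in> rows T"
  obtains k where "k < length (ones T)" "i = fst (ones T ! k)"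
  using assms set_ones[OF assms(1)] unfolding rows_def by (metis imageE in_set_conv_nth)

section \<open>Descents and major index of boxes in terms of words\<close>

lemma connected_intD: "connected_int K \<Longrightarrow> a \<in> K \<Longrightarrow> b \<in> K \<Longrightarrow> a \<le> x \<Longrightarrow> x \<le> b \<Longrightarrow> x \<in> K"
  by (fastforce simp: connected_int_def)

lemma connected_int_Int: "connected_int K \<Longrightarrow> connected_int L \<Longrightarrow> connected_int (K \<inter> L)"
  by (auto simp: connected_int_def)

lemma connected_int_atMost: "connected_int {..i}"
  by (auto simp: connected_int_def)

text \<open>A product of two intervals contains the bounding rectangle of any two of its cells, so
  the containment condition of an NE chain is automatic.\<close>

lemma NE_chain_box:
  assumes "connected_int K" "connected_int J" "c \<in> K \<times> J" "d \<in> K \<times> J"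
  shows "NE_chain (K \<times> J) c d \<longleftrightarrow> fst c < fst d \<and> snd d < snd c"
proof -
  have "{fst c..fst d} \<subseteq> K" "{snd d..snd c} \<subseteq> J"
    using assms by (auto simp: connected_int_def mem_Times_iff simp del: atLeastAtMost_iff)
  then show ?thesis
    unfolding NE_chain_def by blast
qed

definition word_des :: "int list \<Rightarrow> nat" where
  "word_des w = card {k. Suc k < length w \<and> w ! Suc k < w ! k}"

definition word_maj :: "int list \<Rightarrow> nat" where
  "word_maj w = (\<Sum>k<length w. word_des (take (Suc k) w))"

lemma des_box:
  assumes "connected_int K" "connected_int J" "row_filling T" "T \<subseteq> K \<times> J"
  shows "des (K \<times> J) T = word_des (word T)"
proof -
  have in_T: "ones T ! k \<in> T" if "k < length (ones T)" for k
    using that set_ones[OF assms(3)] nth_mem by blast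
  have "NE_chain (K \<times> J) (ones T ! k) (ones T ! Suc k) \<longleftrightarrow> word T ! Suc k < word T ! k"
    if "Suc k < length (ones T)" for k
    using that in_T[of k] in_T[of "Suc k"] assms ones_nth_less_iff[of T k "Suc k"]
    by (subst NE_chain_box) (auto simp: word_def)
  then have "{k. Suc k < length (ones T) \<and> NE_chain (K \<times> J) (ones T ! k) (ones T ! Suc k)}
    = {k. Suc k < length (word T) \<and> word T ! Suc k < word T ! k}"
    by (auto simp: word_def)
  then show ?thesis
    by (simp add: des_def word_des_def)
qed

lemma ones_down_to:
  assumes "row_filling T" "k < length (ones T)"
  shows "ones (down_to (fst (ones T ! k)) T) = take (Suc k) (ones T)"
proof (rule ones_eqI)
  show "sorted_wrt (<) (map fst (take (Suc k) (ones T)))"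
    using sorted_ones[OF assms(1)] by (simp flip: take_map add: sorted_wrt_take)
  show "set (take (Suc k) (ones T)) = down_to (fst (ones T ! k)) T"
  proof (intro equalityI subsetI)
    fix c assume "c \<in> set (take (Suc k) (ones T))"
    then obtain m where m: "m < length (ones T)" "m < Suc k" "c = ones T ! m"
      by (auto simp: in_set_conv_nth)
    then show "c \<in> down_to (fst (ones T ! k)) T"
      using ones_nth_less_iff[OF assms(1) assms(2) m(1)] set_ones[OF assms(1)] nth_mem[of m "ones T"]
      by (auto simp: down_to_def)
  next
    fix c assume c: "c \<in> down_to (fst (ones T ! k)) T"
    then obtain m where m: "m < length (ones T)" "c = ones T ! m"
      using set_ones[OF assms(1)] by (metis (no_types, lifting) down_to_def in_set_conv_nth mem_Collect_eq)
    with c have "m < Suc k"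
      using ones_nth_less_iff[OF assms(1) assms(2) m(1)] by (auto simp: down_to_def)
    then show "c \<in> set (take (Suc k) (ones T))"
      using m by (auto simp: in_set_conv_nth)
  qed
qed

text \<open>Nonempty rows correspond to positions in the word. Cutting below the 1-cell with index
  \<open>k\<close> turns the box into a smaller box and the word into its prefix of length
  \<open>Suc k\<close>, so the geometry disappears.\<close>

lemma maj_rect_box:
  assumes "connected_int K" "connected_int J" "row_filling T" "T \<subseteq> K \<times> J"
  shows "maj_rect (K \<times> J) T = word_maj (word T)"
proof -
  let ?r = "\<lambda>k. fst (ones T ! k)"
  have "rows T = ?r ` {..<length (ones T)}"
    unfolding rows_def by (subst set_ones[OF assms(3), symmetric]) (force simp: set_conv_nth)
  moreover have "inj_on ?r {..<length (ones T)}"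
    by (rule inj_onI) (metis assms(3) lessThan_iff linorder_neq_iff ones_nth_less_iff)
  ultimately have "maj_rect (K \<times> J) T
    = (\<Sum>k<length (ones T). des (down_to (?r k) (K \<times> J)) (down_to (?r k) T))"
    by (simp add: maj_rect_def sum.reindex)
  also have "\<dots> = (\<Sum>k<length (ones T). word_des (take (Suc k) (word T)))"
  proof (rule sum.cong)
    fix k assume k: "k \<in> {..<length (ones T)}"
    have "down_to (?r k) (K \<times> J) = (K \<inter> {..?r k}) \<times> J"
      by (auto simp: down_to_def)
    moreover have "des \<dots> (down_to (?r k) T) = word_des (word (down_to (?r k) T))"
      using assms by (intro des_box connected_int_Int connected_int_atMost)
        (auto simp: down_to_def intro: row_filling_subset)
    ultimately show "des (down_to (?r k) (K \<times> J)) (down_to (?r k) T) = word_des (take (Suc k) (word T))"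
      using k ones_down_to[OF assms(3)] by (simp add: word_def take_map)
  qed simp
  finally show ?thesis
    by (simp add: word_maj_def word_def)
qed

section \<open>Comparing descents by position and by row\<close>

definition same_des :: "int list \<Rightarrow> int list \<Rightarrow> bool" where
  "same_des v w \<longleftrightarrow> length v = length w \<and>
     (\<forall>k. Suc k < length w \<longrightarrow> v ! Suc k < v ! k \<longleftrightarrow> w ! Suc k < w ! k)"

text \<open>Each term of the sum counts the descent positions inside a prefix; the letters enter in
  no other way.\<close>

lemma word_maj_cong: "same_des v w \<Longrightarrow> word_maj v = word_maj w"
  unfolding word_maj_def word_des_def same_des_def
  by (intro sum.cong arg_cong[where f = card] Collect_cong) auto

text \<open>Positions in a word shift when a filling is cut down to some rows or enlarged by other
  cells, whereas a pair of rows keeps its identity; flat boxes need exactly this.\<close>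

definition des_rows :: "cell set \<Rightarrow> (int \<times> int) set" where
  "des_rows T = {(i, i'). i < i' \<and> (\<exists>j j'. (i, j) \<in> T \<and> (i', j') \<in> T \<and> j' < j) \<and>
     (\<forall>k\<in>rows T. \<not> (i < k \<and> k < i'))}"

lemma des_rows_nth_iff:
  assumes "row_filling T" "Suc k < length (ones T)"
  shows "(fst (ones T ! k), fst (ones T ! Suc k)) \<in> des_rows T \<longleftrightarrow> word T ! Suc k < word T ! k"
proof -
  let ?c = "ones T ! k" and ?d = "ones T ! Suc k"
  have "?c \<in> T" "?d \<in> T"
    using assms set_ones[OF assms(1)] nth_mem[of k "ones T"] nth_mem[of "Suc k" "ones T"] by auto
  moreover have "\<not> (fst ?c < i \<and> i < fst ?d)" if "i \<in> rows T" for i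
  proof -
    obtain m where "m < length (ones T)" "i = fst (ones T ! m)"
      using rows_eq_nth[OF assms(1) \<open>i \<in> rows T\<close>] by blast
    then show ?thesis
      using assms by (auto simp: ones_nth_less_iff)
  qed
  moreover have "fst ?c < fst ?d"
    using assms by (simp add: ones_nth_less_iff)
  moreover have "j = snd ?c" if "(fst ?c, j) \<in> T" for j
    using row_filling_unique[OF assms(1), of "fst ?c" j "snd ?c"] that \<open>?c \<in> T\<close> by simp
  moreover have "j = snd ?d" if "(fst ?d, j) \<in> T" for j
    using row_filling_unique[OF assms(1), of "fst ?d" j "snd ?d"] that \<open>?d \<in> T\<close> by simp
  ultimately show ?thesis
    using assms(2) unfolding des_rows_def word_def
    by (auto, metis prod.collapse)
qed

lemma des_rows_imp_nth:
  assumes "row_filling T" "(i, i') \<in> des_rows T"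
  obtains k where "Suc k < length (ones T)" "i = fst (ones T ! k)" "i' = fst (ones T ! Suc k)"
proof -
  have "i \<in> rows T" "i' \<in> rows T" "i < i'"
    using assms(2) by (force simp: des_rows_def rows_def)+
  then obtain k m where km: "k < length (ones T)" "i = fst (ones T ! k)"
      "m < length (ones T)" "i' = fst (ones T ! m)"
    using rows_eq_nth[OF assms(1)] by metis
  then have "k < m"
    using assms(1) \<open>i < i'\<close> by (simp add: ones_nth_less_iff)
  \<comment> \<open>A 1-cell with an index strictly between would occupy a row strictly between,
    against consecutiveness.\<close>
  moreover have "\<not> Suc k < m"
  proof
    assume "Suc k < m"
    then have "ones T ! Suc k \<in> T"
      using km nth_mem[of "Suc k" "ones T"] set_ones[OF assms(1)] by auto
    then have "fst (ones T ! Suc k) \<in> rows T"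
      by (simp add: rows_def)
    with \<open>Suc k < m\<close> show False
      using km assms by (auto simp: des_rows_def ones_nth_less_iff)
  qed
  ultimately have "m = Suc k" by simp
  then show thesis using that km by blast
qed

text \<open>With equal sets of nonempty rows, an index refers to the same row in both fillings, so
  positions and pairs of rows translate into each other.\<close>

lemma same_des_word_iff:
  assumes "row_filling T" "row_filling U" "rows T = rows U"
  shows "same_des (word T) (word U) \<longleftrightarrow> des_rows T = des_rows U"
proof -
  have fst_eq: "map fst (ones T) = map fst (ones U)"
    using assms by (simp add: map_fst_ones)
  then have len: "length (ones T) = length (ones U)"
    using map_eq_imp_length_eq by blast
  have nth_eq: "fst (ones T ! k) = fst (ones U ! k)" if "k < length (ones U)" for k
    using fst_eq that len by (metis nth_map)
  have iff: "(\<forall>k. Suc k < length (ones U) \<longrightarrow>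
      word T ! Suc k < word T ! k \<longleftrightarrow> word U ! Suc k < word U ! k) \<longleftrightarrow>
    (\<forall>k. Suc k < length (ones U) \<longrightarrow> (fst (ones U ! k), fst (ones U ! Suc k)) \<in> des_rows T \<longleftrightarrow>
      (fst (ones U ! k), fst (ones U ! Suc k)) \<in> des_rows U)"
    using des_rows_nth_iff[OF assms(1)] des_rows_nth_iff[OF assms(2)] len nth_eq
    by (metis Suc_lessD)
  show ?thesis
  proof
    assume "same_des (word T) (word U)"
    then have *: "\<forall>k. Suc k < length (ones U) \<longrightarrow>
        (fst (ones U ! k), fst (ones U ! Suc k)) \<in> des_rows T \<longleftrightarrow>
        (fst (ones U ! k), fst (ones U ! Suc k)) \<in> des_rows U"
      unfolding iff[symmetric] using len by (simp add: same_des_def word_def)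
    show "des_rows T = des_rows U"
    proof (intro equalityI subrelI)
      fix i i' assume d: "(i, i') \<in> des_rows T"
      show "(i, i') \<in> des_rows U"
        by (rule des_rows_imp_nth[OF assms(1) d]) (use * d len nth_eq in auto)
    next
      fix i i' assume d: "(i, i') \<in> des_rows U"
      show "(i, i') \<in> des_rows T"
        by (rule des_rows_imp_nth[OF assms(2) d]) (use * d in auto)
    qed
  next
    assume "des_rows T = des_rows U"
    then show "same_des (word T) (word U)"
      using iff len unfolding same_des_def by (simp add: word_def)
  qed
qed

section \<open>The effect of \<open>\<tau>\<close> on words\<close>

lemma same_des_simps [simp]:
  "same_des [] []"
  "same_des [x] [x']"
  "same_des (x # y # v) (x' # y' # w) \<longleftrightarrow> (y < x \<longleftrightarrow> y' < x') \<and> same_des (y # v) (y' # w)"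
  by (auto simp: same_des_def nth_Cons split: nat.splits)

text \<open>A weakly increasing word has no descent and a strictly decreasing one has them
  everywhere, so for two words of the same kind only the length matters.\<close>

lemma same_des_successively:
  assumes "length v = length w"
    and "successively (\<le>) v \<and> successively (\<le>) w \<or> successively (>) v \<and> successively (>) w"
  shows "same_des v w"
  using assms
proof (induction v w rule: list_induct2)
  case (Cons x v y w)
  then show ?case
    by (cases v; cases w) auto
qed simp

text \<open>Only the comparison across the seam is not already covered by the parts.\<close>

lemma same_des_append:
  assumes "same_des v v'" "same_des w w'"
    and "v \<noteq> [] \<Longrightarrow> w \<noteq> [] \<Longrightarrow> hd w < last v \<longleftrightarrow> hd w' < last v'"
  shows "same_des (v @ w) (v' @ w')"
proof -
  have "length v = length v'"
    using assms(1) by (simp add: same_des_def)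
  then show ?thesis
    using assms
  proof (induction v v' rule: list_induct2)
    case (Cons x v y v')
    have "length w = length w'"
      using Cons.prems(2) by (simp add: same_des_def)
    with Cons show ?case
      by (cases v; cases v'; cases w; cases w') auto
  qed simp
qed

lemma same_des_refl: "same_des w w"
  by (simp add: same_des_def)

lemma same_des_trans: "same_des u v \<Longrightarrow> same_des v w \<Longrightarrow> same_des u w"
  by (simp add: same_des_def)

text \<open>The word counterpart of shifting a run: when each cell of the run beginning with
  \<open>x\<close> takes the column of its successor and the last one takes \<open>l\<close>, the
  word loses \<open>x\<close> and gains \<open>l\<close> behind the run. Hence \<open>x\<close> is
  an argument but is not put into the result.\<close>

fun run_insert :: "('a \<Rightarrow> 'a \<Rightarrow> bool) \<Rightarrow> 'a \<Rightarrow> 'a \<Rightarrow> 'a list \<Rightarrow> 'a list" where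
  "run_insert Q l x [] = [l]"
| "run_insert Q l x (y # ys) = (if Q x y then y # run_insert Q l y ys else l # y # ys)"

lemma run_insert_append:
  assumes "successively Q (x # us)" "vs = [] \<or> \<not> Q (last (x # us)) (hd vs)"
  shows "run_insert Q l x (us @ vs) = us @ l # vs"
  using assms
proof (induction us arbitrary: x)
  case Nil
  then show ?case by (cases vs) auto
qed (auto simp: successively_Cons)

lemma run_insert_split:
  obtains us vs where "ys = us @ vs" "successively Q (x # us)"
    "vs = [] \<or> \<not> Q (last (x # us)) (hd vs)"
proof -
  have "\<exists>us vs. ys = us @ vs \<and> successively Q (x # us) \<and> (vs = [] \<or> \<not> Q (last (x # us)) (hd vs))"
  proof (induction ys arbitrary: x)
    case (Cons y ys)
    show ?case
    proof (cases "Q x y")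
      case True
      obtain us vs where "ys = us @ vs" "successively Q (y # us)" "vs = [] \<or> \<not> Q (last (y # us)) (hd vs)"
        using Cons.IH[of y] by blast
      then show ?thesis
        using True by (intro exI[of _ "y # us"] exI[of _ vs]) simp
    next
      case False
      then show ?thesis
        by (intro exI[of _ "[]"] exI[of _ "y # ys"]) simp
    qed
  qed simp
  then show thesis using that by blast
qed

text \<open>A run that reaches the maximal letter \<open>l\<close> can only continue through further
  copies of \<open>l\<close>, and inserting \<open>l\<close> before or behind such a block gives the
  same word. Stopping before the block makes the new \<open>l\<close> its topmost member.\<close>

lemma run_insert_cong_max:
  fixes l :: "'a :: linorder"
  assumes "\<forall>y\<in>set ys. y \<le> l"
  shows "run_insert (\<le>) l x ys = run_insert (\<lambda>x y. x \<le> y \<and> y \<noteq> l) l x ys"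
proof -
  have max: "run_insert (\<le>) l l zs = l # zs" if "\<forall>y\<in>set zs. y \<le> l" for zs
    using that by (induction zs) auto
  have max': "run_insert (\<lambda>x y. x \<le> y \<and> y \<noteq> l) l l zs = l # zs" if "\<forall>y\<in>set zs. y \<le> l" for zs
    using that by (cases zs) auto
  show ?thesis
    using assms by (induction ys arbitrary: x) (auto simp: max max')
qed

lemma successively_le_snoc:
  fixes l :: "'a :: linorder"
  shows "successively (\<le>) v \<Longrightarrow> \<forall>x\<in>set v. x \<le> l \<Longrightarrow> successively (\<le>) (v @ [l])"
  by (cases "v = []") (simp_all add: successively_append_iff)

section \<open>A single pass on words and its inverse\<close>

lemma takeWhile_dropWhile_first:
  assumes "l \<notin> set p"
  shows "takeWhile (\<lambda>x. x \<noteq> l) (p @ l # q) = p" "dropWhile (\<lambda>x. x \<noteq> l) (p @ l # q) = l # q"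
  using assms by (induction p) auto

text \<open>\<open>us\<close> and \<open>vs\<close> are the letters above and below the processed
  \<open>a\<close>. Only unprocessed cells of the first column still carry the letter
  \<open>a\<close>, so \<open>last us = a\<close> expresses that the cell right above is the
  preceding cell of the first column. Cases (a) and (b) merge, since an empty list below just yields
  \<open>[l]\<close>.\<close>

definition tau_word_at :: "int \<Rightarrow> int \<Rightarrow> int list \<Rightarrow> int list \<Rightarrow> int list" where
  "tau_word_at a l us vs =
     (if us = [] \<or> last us = a \<or> (vs \<noteq> [] \<and> hd vs < last us) then us @ run_insert (\<le>) l a vs
      else rev (run_insert (<) l a (rev us)) @ vs)"

text \<open>The reversals pick out the last \<open>a\<close>, which is the lowest cell not yet
  processed.\<close>

definition tau_word :: "int \<Rightarrow> int \<Rightarrow> int list \<Rightarrow> int list" where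
  "tau_word a l w =
     tau_word_at a l (rev (tl (dropWhile (\<lambda>x. x \<noteq> a) (rev w)))) (rev (takeWhile (\<lambda>x. x \<noteq> a) (rev w)))"

text \<open>\<open>p\<close> and \<open>q\<close> are the letters above and below the topmost
  \<open>l\<close>. The test recognises an upward pass: there is a descent right below
  \<open>l\<close>, and its lower letter forms no descent with the end of \<open>p\<close>. Then
  \<open>a\<close> returns to the lower end of the strictly decreasing run, otherwise to the upper
  end of the weakly increasing run that ends in \<open>l\<close>; the condition
  \<open>y \<noteq> a\<close> keeps that run from swallowing the next cell of column
  \<open>a\<close>.\<close>

definition tau_word_inv :: "int \<Rightarrow> int \<Rightarrow> int list \<Rightarrow> int list" where
  "tau_word_inv a l w =
     (let p = takeWhile (\<lambda>x. x \<noteq> l) w; q = tl (dropWhile (\<lambda>x. x \<noteq> l) w) in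
      if q \<noteq> [] \<and> hd q < l \<and> (p = [] \<or> last p \<le> hd q) then p @ run_insert (>) a l q
      else rev (run_insert (\<lambda>x y. y \<le> x \<and> y \<noteq> a) a l (rev p)) @ q)"

lemma tau_word_append: "a \<notin> set vs \<Longrightarrow> tau_word a l (us @ a # vs) = tau_word_at a l us vs"
  using takeWhile_dropWhile_first[of a "rev vs" "rev us"] by (simp add: tau_word_def)

text \<open>The letter \<open>l\<close> is the column added by \<open>\<tau>\<close>; its 1-cells always lie below those 1-cells of
  column \<open>a\<close> that are still to be moved.\<close>

definition tau_admissible :: "int \<Rightarrow> int \<Rightarrow> int list \<Rightarrow> bool" where
  "tau_admissible a l w \<longleftrightarrow> a < l \<and> set w \<subseteq> {a..l} \<and>
     (\<exists>xs ys. w = xs @ ys \<and> l \<notin> set xs \<and> a \<notin> set ys)"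

lemma tau_admissible_split:
  assumes "tau_admissible a l w" "a \<in> set w"
  obtains us vs where "w = us @ a # vs" "a \<notin> set vs" "l \<notin> set us"
proof -
  obtain us vs where w: "w = us @ a # vs" "a \<notin> set vs"
    using assms(2) split_list_last by metis
  obtain xs ys where xs: "w = xs @ ys" "l \<notin> set xs" "a \<notin> set ys"
    using assms(1) by (auto simp: tau_admissible_def)
  obtain zs where "us = xs @ zs \<and> zs @ a # vs = ys \<or> us @ zs = xs \<and> a # vs = zs @ ys"
    using w(1) xs(1) append_eq_append_conv2[of us "a # vs" xs ys] by auto
  then have "l \<notin> set us"
    using xs(2,3) by auto
  with w show thesis using that by blast
qed

text \<open>The two shapes of a pass, with the conditions at the seams from which both invariance of
  descents and invertibility are read off. The run \<open>v1\<close> stops before any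
  \<open>l\<close>, so the inserted \<open>l\<close> is topmost.\<close>

lemma tau_word_cases:
  assumes "tau_admissible a l w" "a \<in> set w"
  obtains
    (down) us v1 v2 where "w = us @ a # v1 @ v2" "tau_word a l w = us @ v1 @ l # v2"
      "a \<notin> set (v1 @ v2)" "l \<notin> set (us @ v1)" "successively (\<le>) (a # v1)"
      "v2 = [] \<or> hd v2 = l \<or> hd v2 < last (a # v1)"
      "us = [] \<or> last us = a \<or> v1 \<noteq> [] \<and> hd v1 < last us"
  | (up) u1 u2 vs where "w = u1 @ u2 @ a # vs" "tau_word a l w = u1 @ l # u2 @ vs"
      "a \<notin> set (u2 @ vs)" "l \<notin> set (u1 @ u2)" "successively (>) (u2 @ [a])" "u2 \<noteq> []"
      "vs = [] \<or> last u2 \<le> hd vs" "u1 = [] \<or> last u1 \<le> hd u2"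
proof -
  obtain us vs where w: "w = us @ a # vs" "a \<notin> set vs" "l \<notin> set us"
    by (rule tau_admissible_split[OF assms])
  have tw: "tau_word a l w = tau_word_at a l us vs"
    using w by (simp add: tau_word_append)
  have bounds: "a < l" "\<forall>x\<in>set us. a \<le> x \<and> x \<le> l" "\<forall>x\<in>set vs. a \<le> x \<and> x \<le> l"
    using assms(1) w(1) by (auto simp: tau_admissible_def)
  show thesis
  proof (cases "us = [] \<or> last us = a \<or> (vs \<noteq> [] \<and> hd vs < last us)")
    case True
    let ?Q = "\<lambda>x y :: int. x \<le> y \<and> y \<noteq> l"
    obtain v1 v2 where v: "vs = v1 @ v2" "successively ?Q (a # v1)"
      "v2 = [] \<or> \<not> ?Q (last (a # v1)) (hd v2)"
      by (rule run_insert_split)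
    have "run_insert (\<le>) l a vs = v1 @ l # v2"
      using v bounds by (simp add: run_insert_cong_max run_insert_append)
    then have "tau_word a l w = us @ v1 @ l # v2"
      using tw True by (auto simp: tau_word_at_def)
    moreover have "successively (\<le>) (a # v1)"
      using v(2) by (rule successively_mono) auto
    moreover have "l \<notin> set v1"
    proof -
      have "l \<notin> set v" if "successively ?Q (x # v)" for x v
        using that by (induction v arbitrary: x) auto
      then show ?thesis using v(2) by blast
    qed
    \<comment> \<open>No letter is smaller than \<open>a\<close>, so an empty \<open>v1\<close>
      means that \<open>vs\<close> is empty or begins with the maximal letter \<open>l\<close>; then
      \<open>hd vs < last us\<close> is impossible and one of the other two alternatives
      holds.\<close>
    moreover have "us = [] \<or> last us = a \<or> v1 \<noteq> [] \<and> hd v1 < last us"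
    proof (cases "v1 = []")
      case v1: True
      then have "vs = [] \<or> hd vs = l \<or> hd vs < a"
        using v by auto
      then have "vs = [] \<or> hd vs = l"
        using bounds(3) by (cases vs) auto
      moreover have "last us \<le> l" if "us \<noteq> []"
        using bounds(2) that by simp
      ultimately show ?thesis
        using True by auto
    qed (use True v(1) in auto)
    moreover have "v2 = [] \<or> hd v2 = l \<or> hd v2 < last (a # v1)"
      using v(3) by linarith
    ultimately show thesis
      using w v(1) by (intro down[of us v1 v2]) simp_all
  next
    case False
    obtain r1 r2 where r: "rev us = r1 @ r2" "successively (<) (a # r1)"
      "r2 = [] \<or> \<not> last (a # r1) < hd r2"
      by (rule run_insert_split)
    let ?u1 = "rev r2" and ?u2 = "rev r1"
    have us: "us = ?u1 @ ?u2"
      using r(1) by (metis rev_append rev_rev_ident)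
    have "tau_word a l w = ?u1 @ l # ?u2 @ vs"
      using tw False r run_insert_append[OF r(2,3)] by (simp add: tau_word_at_def)
    moreover have succ: "successively (>) (?u2 @ [a])"
    proof -
      have "successively (\<lambda>x y. y < x) (rev (a # r1))"
        unfolding successively_rev using r(2) by simp
      then show ?thesis by simp
    qed
    \<comment> \<open>Otherwise the letter right above is at most \<open>a\<close>, hence equal to
      \<open>a\<close>, which this case excludes.\<close>
    moreover have "r1 \<noteq> []"
    proof
      assume "r1 = []"
      then have "hd r2 \<le> a" "hd r2 = last us"
        using r(3) False us by (auto simp: last_rev)
      moreover have "a \<le> last us"
        using bounds(2) False last_in_set by blast
      ultimately show False using False by simp
    qed
    moreover have "a \<notin> set r1"
    proof -
      have "sorted_wrt (<) (a # r1)"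
        using r(2) by (simp add: successively_conv_sorted_wrt)
      then show ?thesis by auto
    qed
    moreover have "vs = [] \<or> last ?u2 \<le> hd vs"
      using False us \<open>r1 \<noteq> []\<close> by (auto simp: not_less)
    moreover have "?u1 = [] \<or> last ?u1 \<le> hd ?u2"
      using r(3) \<open>r1 \<noteq> []\<close> by (auto simp: last_rev hd_rev)
    ultimately show thesis
      using w us by (intro up[of ?u1 ?u2 vs]) simp_all
  qed
qed

text \<open>The rewritten middle part is weakly increasing before and after a downward pass,
  strictly decreasing before and after an upward one, so only the seams remain. Below a downward run
  both words have a descent unless \<open>v2\<close> is empty or begins with \<open>l\<close>; above
  it, \<open>last us = a\<close> gives none in either word and \<open>hd v1 < last us\<close> one in
  both. At the seams of an upward pass neither word has a descent.\<close>

lemma tau_word_same_des: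
  assumes "tau_admissible a l w" "a \<in> set w"
  shows "same_des w (tau_word a l w)"
proof -
  have bounds: "a < l" "\<forall>x\<in>set w. a \<le> x \<and> x \<le> l"
    using assms(1) by (auto simp: tau_admissible_def)
  show ?thesis
    using assms
  proof (cases rule: tau_word_cases)
    case (down us v1 v2)
    have le: "\<forall>x\<in>set us. a \<le> x \<and> x \<le> l" "\<forall>x\<in>set v1. a \<le> x \<and> x \<le> l" "\<forall>x\<in>set v2. a \<le> x \<and> x \<le> l"
      using bounds(2) down(1) by auto
    have "successively (\<le>) (v1 @ [l])"
      using down(5) le by (intro successively_le_snoc) (auto simp: successively_Cons)
    then have mid: "same_des (a # v1) (v1 @ [l])"
      using down(5) by (intro same_des_successively) auto
    have "same_des ((a # v1) @ v2) ((v1 @ [l]) @ v2)"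
    proof (rule same_des_append[OF mid same_des_refl])
      assume "v2 \<noteq> []"
      then have "hd v2 = l \<or> hd v2 < last (a # v1)" "hd v2 \<le> l" "last (a # v1) \<le> l"
        using down(6) le bounds(1) by auto
      then show "hd v2 < last (a # v1) \<longleftrightarrow> hd v2 < last (v1 @ [l])"
        by auto
    qed
    then have "same_des (us @ (a # v1) @ v2) (us @ (v1 @ [l]) @ v2)"
    proof (rule same_des_append[OF same_des_refl])
      assume "us \<noteq> []"
      then have "a \<le> last us" "last us \<le> l"
        using le by auto
      moreover have "a \<le> hd (v1 @ [l])"
        using le bounds(1) by (cases v1) auto
      ultimately show "hd ((a # v1) @ v2) < last us \<longleftrightarrow> hd ((v1 @ [l]) @ v2) < last us"
        using down(7) \<open>us \<noteq> []\<close> le by (cases v1) force+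
    qed
    then show ?thesis
      unfolding down(2) by (simp add: down(1))
  next
    case (up u1 u2 vs)
    have le: "\<forall>x\<in>set u1. a \<le> x \<and> x \<le> l" "\<forall>x\<in>set u2. a \<le> x \<and> x < l" "\<forall>x\<in>set vs. a \<le> x \<and> x \<le> l"
      using bounds(2) up(1,4) by (auto simp: order_less_le)
    have "successively (>) (l # u2)"
      using up(5) le \<open>u2 \<noteq> []\<close> by (auto simp: successively_append_iff successively_Cons)
    then have mid: "same_des (u2 @ [a]) (l # u2)"
      using up(5) by (intro same_des_successively) auto
    have "same_des ((u2 @ [a]) @ vs) ((l # u2) @ vs)"
    proof (rule same_des_append[OF mid same_des_refl])
      assume "vs \<noteq> []"
      then have "a \<le> hd vs"
        using le(3) by simp
      then show "hd vs < last (u2 @ [a]) \<longleftrightarrow> hd vs < last (l # u2)"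
        using up(6,7) \<open>vs \<noteq> []\<close> by auto
    qed
    then have "same_des (u1 @ (u2 @ [a]) @ vs) (u1 @ (l # u2) @ vs)"
    proof (rule same_des_append[OF same_des_refl])
      assume "u1 \<noteq> []"
      then have "last u1 \<le> l"
        using le(1) by simp
      then show "hd ((u2 @ [a]) @ vs) < last u1 \<longleftrightarrow> hd ((l # u2) @ vs) < last u1"
        using up(6,8) \<open>u1 \<noteq> []\<close> by auto
    qed
    then show ?thesis
      unfolding up(2) by (simp add: up(1))
  qed
qed

lemma tau_word_filter:
  assumes "tau_admissible a l w" "a \<in> set w" "\<not> Q a" "\<not> Q l"
  shows "filter Q (tau_word a l w) = filter Q w"
  using assms(1,2)
proof (cases rule: tau_word_cases)
  case (down us v1 v2)
  show ?thesis unfolding down(2) using assms(3,4) by (simp add: down(1))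
next
  case (up u1 u2 vs)
  show ?thesis unfolding up(2) using assms(3,4) by (simp add: up(1))
qed

text \<open>Summands on both sides avoid truncated subtraction.\<close>

lemma tau_word_count:
  assumes "tau_admissible a l w" "a \<in> set w"
  shows "count_list (tau_word a l w) x + (if x = a then 1 else 0) =
    count_list w x + (if x = l then 1 else 0)"
  using assms
proof (cases rule: tau_word_cases)
  case (down us v1 v2)
  show ?thesis unfolding down(2) by (simp add: down(1))
next
  case (up u1 u2 vs)
  show ?thesis unfolding up(2) by (simp add: up(1))
qed

text \<open>The processed \<open>a\<close> was the lowest one, so a cut right behind
  \<open>us\<close> or \<open>u1\<close> has no \<open>l\<close> above it and no \<open>a\<close>
  below it.\<close>

lemma tau_word_admissible:
  assumes "tau_admissible a l w" "a \<in> set w"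
  shows "tau_admissible a l (tau_word a l w)"
  using assms
proof (cases rule: tau_word_cases)
  case (down us v1 v2)
  have "\<exists>xs ys. us @ v1 @ l # v2 = xs @ ys \<and> l \<notin> set xs \<and> a \<notin> set ys"
    by (rule exI[of _ us], rule exI[of _ "v1 @ l # v2"])
      (use down assms(1) in \<open>auto simp: tau_admissible_def\<close>)
  then show ?thesis
    unfolding down(2) using assms(1) down(1) by (auto simp: tau_admissible_def)
next
  case (up u1 u2 vs)
  have "\<exists>xs ys. u1 @ l # u2 @ vs = xs @ ys \<and> l \<notin> set xs \<and> a \<notin> set ys"
    by (rule exI[of _ u1], rule exI[of _ "l # u2 @ vs"])
      (use up assms(1) in \<open>auto simp: tau_admissible_def\<close>)
  then show ?thesis
    unfolding up(2) using assms(1) up(1) by (auto simp: tau_admissible_def)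
qed

text \<open>The inserted \<open>l\<close> is topmost, so \<open>takeWhile\<close> finds it in both
  shapes; it remains to see that the test recognises the shape and that the reverse run ends where
  the original one began.\<close>

lemma tau_word_inv_tau_word:
  assumes "tau_admissible a l w" "a \<in> set w"
  shows "tau_word_inv a l (tau_word a l w) = w"
proof -
  have bounds: "a < l" "\<forall>x\<in>set w. a \<le> x \<and> x \<le> l"
    using assms(1) by (auto simp: tau_admissible_def)
  show ?thesis
    using assms
  proof (cases rule: tau_word_cases)
    case (down us v1 v2)
    have le: "\<forall>x\<in>set v1. a \<le> x \<and> x \<le> l" "\<forall>x\<in>set v2. a \<le> x \<and> x \<le> l"
      using bounds(2) down(1) by auto
    let ?Q = "\<lambda>x y :: int. y \<le> x \<and> y \<noteq> a"
    have "successively (\<lambda>x y. ?Q y x) (v1 @ [l])"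
    proof -
      have "successively (\<le>) (v1 @ [l])"
        using down(5) le by (intro successively_le_snoc) (auto simp: successively_Cons)
      then have "sorted_wrt (\<le>) (v1 @ [l])"
        by (simp add: successively_conv_sorted_wrt)
      moreover have "a \<notin> set v1"
        using down(3) by simp
      ultimately have "sorted_wrt (\<lambda>x y. ?Q y x) (v1 @ [l])"
        by (induction v1) auto
      then show ?thesis
        by (rule successively_if_sorted_wrt)
    qed
    then have succ: "successively ?Q (l # rev v1)"
      using successively_rev[of ?Q "v1 @ [l]"] by simp
    \<comment> \<open>Read upwards, the run cannot enter a nonempty \<open>us\<close>: the last
      letter of \<open>us\<close> is \<open>a\<close>, which \<open>?Q\<close> excludes, or exceeds
      \<open>hd v1\<close>.\<close>
    have stop: "rev us = [] \<or> \<not> ?Q (last (l # rev v1)) (hd (rev us))"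
      using down(7) by (cases v1) (auto simp: hd_rev last_rev)
    \<comment> \<open>If \<open>v2\<close> begins with a letter smaller than \<open>l\<close>, this
      letter is smaller than \<open>last (a # v1)\<close>. For nonempty \<open>v1\<close> this
      contradicts the test, for empty \<open>v1\<close> the letter would be smaller than
      \<open>a\<close>.\<close>
    have not_up: "\<not> (v2 \<noteq> [] \<and> hd v2 < l \<and> (us @ v1 = [] \<or> last (us @ v1) \<le> hd v2))"
    proof
      assume h: "v2 \<noteq> [] \<and> hd v2 < l \<and> (us @ v1 = [] \<or> last (us @ v1) \<le> hd v2)"
      then have "hd v2 < last (a # v1)" "a \<le> hd v2"
        using down(6) le by auto
      then show False
        using h by (cases "v1 = []") auto
    qed
    have tw: "takeWhile (\<lambda>x. x \<noteq> l) (tau_word a l w) = us @ v1"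
      "tl (dropWhile (\<lambda>x. x \<noteq> l) (tau_word a l w)) = v2"
      unfolding down(2) using takeWhile_dropWhile_first[OF down(4), of v2] by simp_all
    show ?thesis
      unfolding tau_word_inv_def Let_def tw if_not_P[OF not_up]
      using run_insert_append[OF succ stop, of a] by (simp add: down(1))
  next
    case (up u1 u2 vs)
    have le: "\<forall>x\<in>set u2. a \<le> x \<and> x < l"
      using bounds(2) up(1,4) by (auto simp: order_less_le)
    have succ: "successively (>) (l # u2)"
      using up(5) le \<open>u2 \<noteq> []\<close> by (auto simp: successively_append_iff successively_Cons)
    have stop: "vs = [] \<or> \<not> hd vs < last (l # u2)"
      using up(6,7) by auto
    have is_up: "u2 @ vs \<noteq> [] \<and> hd (u2 @ vs) < l \<and> (u1 = [] \<or> last u1 \<le> hd (u2 @ vs))"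
      using up(6,8) le by auto
    have tw: "takeWhile (\<lambda>x. x \<noteq> l) (tau_word a l w) = u1"
      "tl (dropWhile (\<lambda>x. x \<noteq> l) (tau_word a l w)) = u2 @ vs"
      unfolding up(2) using takeWhile_dropWhile_first[of l u1 "u2 @ vs"] up(4) by simp_all
    show ?thesis
      unfolding tau_word_inv_def Let_def tw if_P[OF is_up]
      using run_insert_append[OF succ stop, of a] by (simp add: up(1))
  qed
qed

text \<open>The claims are proved in one induction: the count guarantees that an \<open>a\<close> is
  left for the next pass, and admissibility that the lemmas on a single pass apply.\<close>

lemma tau_word_iterate:
  assumes "tau_admissible a l w" "k \<le> count_list w a"
  shows "tau_admissible a l ((tau_word a l ^^ k) w)"
    and "count_list ((tau_word a l ^^ k) w) x + (if x = a then k else 0) =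
      count_list w x + (if x = l then k else 0)"
    and "same_des w ((tau_word a l ^^ k) w)"
    and "\<not> Q a \<Longrightarrow> \<not> Q l \<Longrightarrow> filter Q ((tau_word a l ^^ k) w) = filter Q w"
proof -
  have "tau_admissible a l ((tau_word a l ^^ k) w) \<and>
    (\<forall>x. count_list ((tau_word a l ^^ k) w) x + (if x = a then k else 0) =
      count_list w x + (if x = l then k else 0)) \<and>
    same_des w ((tau_word a l ^^ k) w) \<and>
    (\<not> Q a \<longrightarrow> \<not> Q l \<longrightarrow> filter Q ((tau_word a l ^^ k) w) = filter Q w)"
    using assms(2)
  proof (induction k)
    case 0
    then show ?case using assms(1) by (simp add: same_des_refl)
  next
    case (Suc k)
    let ?w = "(tau_word a l ^^ k) w"
    have IH: "tau_admissible a l ?w"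
      "\<And>x. count_list ?w x + (if x = a then k else 0) = count_list w x + (if x = l then k else 0)"
      "same_des w ?w" "\<not> Q a \<longrightarrow> \<not> Q l \<longrightarrow> filter Q ?w = filter Q w"
      using Suc by auto
    have "a \<noteq> l"
      using assms(1) by (simp add: tau_admissible_def)
    then have "count_list ?w a \<noteq> 0"
      using IH(2)[of a] Suc.prems by simp
    then have a: "a \<in> set ?w"
      by (simp add: count_list_0_iff)
    have "count_list (tau_word a l ?w) x + (if x = a then Suc k else 0) =
      count_list w x + (if x = l then Suc k else 0)" for x
      using tau_word_count[OF IH(1) a, of x] IH(2)[of x] by (auto split: if_splits)
    then show ?case
      using tau_word_admissible[OF IH(1) a] tau_word_filter[OF IH(1) a, of Q]
        tau_word_same_des[OF IH(1) a] IH(3,4) same_des_trans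
      by auto
  qed
  then show "tau_admissible a l ((tau_word a l ^^ k) w)"
    and "count_list ((tau_word a l ^^ k) w) x + (if x = a then k else 0) =
      count_list w x + (if x = l then k else 0)"
    and "same_des w ((tau_word a l ^^ k) w)"
    and "\<not> Q a \<Longrightarrow> \<not> Q l \<Longrightarrow> filter Q ((tau_word a l ^^ k) w) = filter Q w"
    by blast+
qed

text \<open>Passes are peeled off one at a time with \<open>tau_word_inv\<close>, which presupposes
  the same number of passes on both sides.\<close>

lemma tau_word_iterate_inj:
  assumes "tau_admissible a l v" "tau_admissible a l w" "k \<le> count_list v a" "k \<le> count_list w a"
    and "(tau_word a l ^^ k) v = (tau_word a l ^^ k) w"
  shows "v = w"
  using assms(3-)
proof (induction k)
  case (Suc k)
  have mem: "a \<in> set ((tau_word a l ^^ k) u)"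
    if "tau_admissible a l u" "Suc k \<le> count_list u a" for u
  proof -
    have "a \<noteq> l" using that(1) by (simp add: tau_admissible_def)
    then have "count_list ((tau_word a l ^^ k) u) a \<noteq> 0"
      using tau_word_iterate(2)[OF that(1), of k a] that(2) by simp
    then show ?thesis by (simp add: count_list_0_iff)
  qed
  have inv: "tau_word_inv a l ((tau_word a l ^^ Suc k) u) = (tau_word a l ^^ k) u"
    if "tau_admissible a l u" "Suc k \<le> count_list u a" for u
    using tau_word_inv_tau_word[OF tau_word_iterate(1)[OF that(1)] mem[OF that]] that(2) by simp
  have "(tau_word a l ^^ k) v = (tau_word a l ^^ k) w"
    using inv[OF assms(1) Suc.prems(1)] inv[OF assms(2) Suc.prems(2)] Suc.prems(3) by metis
  then show ?case
    using Suc by simp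
qed simp

section \<open>From cells to words\<close>

lemma length_run_insert [simp]: "length (run_insert Q l x ys) = Suc (length ys)"
  by (induction Q l x ys rule: run_insert.induct) auto

lemma initial_run_Cons: "\<exists>zs. initial_run Q (x # xs) = x # zs"
  by (cases xs) auto

lemma shift_cells_single: "shift_cells l [(i, x)] T = insert (i, l) (T - {(i, x)})"
  by (auto simp: shift_cells_def)

lemma shift_cells_Cons2:
  "shift_cells l ((i, x) # (i', y) # Ds) T =
     insert (i, y) (shift_cells l ((i', y) # Ds) (T - {(i, x)}))"
  by (auto simp: shift_cells_def)

text \<open>\<open>U\<close> collects the cells on the other side of the starting cell, in rows that
  the run never visits. Cells and columns are compared only for pairs in list order, because NE
  chains presuppose the vertical order.\<close>

lemma shift_cells_initial_run:
  assumes "length is = length ys" "distinct (i # is)" "\<forall>u\<in>U. fst u \<notin> set (i # is)"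
    and "sorted_wrt (\<lambda>c d. Q c d \<longleftrightarrow> Q' (snd c) (snd d)) ((i, x) # zip is ys)"
  shows "shift_cells l (initial_run Q ((i, x) # zip is ys)) (set ((i, x) # zip is ys) \<union> U) =
    set (zip (i # is) (run_insert Q' l x ys)) \<union> U"
  using assms
proof (induction "is" ys arbitrary: i x rule: list_induct2)
  case Nil
  then show ?case by (auto simp: shift_cells_single)
next
  case (Cons i' "is" y ys)
  have notin: "(i, x) \<notin> set ((i', y) # zip is ys) \<union> U"
    using Cons.prems by (auto dest: set_zip_leftD)
  then have diff: "set ((i, x) # (i', y) # zip is ys) \<union> U - {(i, x)} = set ((i', y) # zip is ys) \<union> U"
    by auto
  have Q: "Q (i, x) (i', y) \<longleftrightarrow> Q' x y"
    using Cons.prems by simp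
  obtain zs where zs: "initial_run Q ((i', y) # zip is ys) = (i', y) # zs"
    using initial_run_Cons[of Q "(i', y)" "zip is ys"] by blast
  have IH: "shift_cells l ((i', y) # zs) (set ((i', y) # zip is ys) \<union> U) =
      set (zip (i' # is) (run_insert Q' l y ys)) \<union> U"
    unfolding zs[symmetric] using Cons.prems by (intro Cons.IH) auto
  show ?case
  proof (cases "Q' x y")
    case True
    have "initial_run Q ((i, x) # zip (i' # is) (y # ys)) = (i, x) # (i', y) # zs"
      using Q True zs by simp
    then show ?thesis
      using IH True diff by (simp add: shift_cells_Cons2 del: set_simps) simp
  next
    case False
    have "initial_run Q ((i, x) # zip (i' # is) (y # ys)) = [(i, x)]"
      using Q False by simp
    then show ?thesis
      using False diff by (simp add: shift_cells_single del: set_simps) simp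
  qed
qed

lemma rev_zip: "length xs = length ys \<Longrightarrow> rev (zip xs ys) = zip (rev xs) (rev ys)"
  by (simp add: zip_rev)

text \<open>\<open>us\<close> and \<open>vs\<close> are the columns of the cells above and below the
  moved cell \<open>(c, a)\<close>. The hypothesis on \<open>Cs ! (r - 1)\<close> translates the
  identity of cells tested in \<open>tau_step\<close> into the letter test of
  \<open>tau_word_at\<close>.\<close>

lemma tau_step_eq:
  assumes H: "connected_int H" and rs: "sorted_wrt (<) rs" "set rs \<subseteq> H" "rs = r1 @ c # r2"
    and w: "set w \<subseteq> {a..l}" "w = us @ a # vs" and len: "length r1 = length us" "length r2 = length vs"
    and Cs: "Cs ! r = (c, a)"
    and prev: "us \<noteq> [] \<Longrightarrow> 0 < r \<and> (last r1, last us) = Cs ! (r - 1) \<longleftrightarrow> last us = a"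
  shows "tau_step (H \<times> {a..l}) l Cs r (set (zip rs w)) = set (zip rs (tau_word_at a l us vs))"
proof -
  let ?S = "H \<times> {a..l}" and ?T = "set (zip rs w)"
  let ?A = "set (zip r1 us)" and ?B = "set (zip r2 vs)"
  have zip: "zip rs w = zip r1 us @ (c, a) # zip r2 vs"
    using rs(3) w(2) len by simp
  have less: "\<forall>i\<in>set r1. i < c" "\<forall>i\<in>set r2. c < i" "\<forall>i\<in>set r1. \<forall>i'\<in>set r2. i < i'"
    "sorted_wrt (<) r1" "sorted_wrt (<) r2"
    using rs(1,3) by (auto simp: sorted_wrt_append intro: less_trans)
  have dist: "distinct (c # r2)" "distinct (c # rev r1)"
    using less by (auto simp: strict_sorted_iff)
  have T: "?T = set ((c, a) # zip r2 vs) \<union> ?A" "?T = set ((c, a) # zip (rev r1) (rev us)) \<union> ?B"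
    unfolding zip using len by (auto simp flip: rev_zip)
  have ones: "ones ?T = zip r1 us @ (c, a) # zip r2 vs"
    unfolding zip[symmetric] using rs w len by (intro ones_zip) auto
  have up: "rev (filter (\<lambda>d. fst d < c) (ones ?T)) = zip (rev r1) (rev us)"
  proof -
    have "filter (\<lambda>d. fst d < c) (zip r1 us) = zip r1 us"
      using less by (auto simp: filter_id_conv dest: set_zip_leftD)
    moreover have "filter (\<lambda>d. fst d < c) (zip r2 vs) = []"
      using less by (fastforce simp: filter_empty_conv dest: set_zip_leftD)
    ultimately show ?thesis
      using len by (simp add: ones rev_zip)
  qed
  have dn: "filter (\<lambda>d. c < fst d) (ones ?T) = zip r2 vs"
  proof -
    have "filter (\<lambda>d. c < fst d) (zip r2 vs) = zip r2 vs"
      using less by (auto simp: filter_id_conv dest: set_zip_leftD)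
    moreover have "filter (\<lambda>d. c < fst d) (zip r1 us) = []"
      using less by (fastforce simp: filter_empty_conv dest: set_zip_leftD)
    ultimately show ?thesis
      by (simp add: ones)
  qed
  have in_S: "d \<in> ?S" if "d \<in> ?T" for d
    using that rs(2) w(1) set_zip_leftD[of "fst d" "snd d" rs w] set_zip_rightD[of "fst d" "snd d" rs w]
    by (auto simp: mem_Times_iff)
  have NE: "NE_chain ?S d d' \<longleftrightarrow> snd d' < snd d" if "d \<in> ?T" "d' \<in> ?T" "fst d < fst d'" for d d'
    using that in_S H by (subst NE_chain_box) (auto simp: connected_int_def)
  have dn_run: "shift_cells l (initial_run (\<lambda>d d'. \<not> NE_chain ?S d d') ((c, a) # zip r2 vs)) ?T =
      set (zip rs (us @ run_insert (\<le>) l a vs))"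
  proof -
    have "sorted_wrt (\<lambda>d d'. fst d < fst d') ((c, a) # zip r2 vs)"
      using less len by (auto simp: dest: set_zip_leftD simp flip: sorted_wrt_map[where f = fst])
    then have srt: "sorted_wrt (\<lambda>d d'. (\<not> NE_chain ?S d d') \<longleftrightarrow> snd d \<le> snd d') ((c, a) # zip r2 vs)"
    proof (rule sorted_wrt_mono_rel[rotated])
      fix d d' assume "d \<in> set ((c, a) # zip r2 vs)" "d' \<in> set ((c, a) # zip r2 vs)"
        and less: "fst d < fst d'"
      then have "d \<in> ?T" "d' \<in> ?T"
        unfolding T(1) by blast+
      then show "(\<not> NE_chain ?S d d') \<longleftrightarrow> snd d \<le> snd d'"
        using NE less by (simp add: not_less)
    qed
    have "\<forall>u\<in>?A. fst u \<notin> set (c # r2)"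
      using less by (fastforce dest: set_zip_leftD)
    moreover have "set (zip rs (us @ run_insert (\<le>) l a vs)) =
        set (zip (c # r2) (run_insert (\<le>) l a vs)) \<union> ?A"
      using len by (simp add: rs(3) Un_commute)
    ultimately show ?thesis
      unfolding T(1) using shift_cells_initial_run[OF len(2) dist(1) _ srt] by simp
  qed
  have up_run: "shift_cells l (initial_run (\<lambda>d d'. NE_chain ?S d' d) ((c, a) # zip (rev r1) (rev us))) ?T =
      set (zip rs (rev (run_insert (<) l a (rev us)) @ vs))"
  proof -
    have "sorted_wrt (\<lambda>d d'. fst d' < fst d) ((c, a) # zip (rev r1) (rev us))"
      using less len
      by (auto simp: dest: set_zip_leftD simp flip: sorted_wrt_map[where f = fst and R = "\<lambda>x y. y < x"])
        (simp add: sorted_wrt_rev)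
    then have srt: "sorted_wrt (\<lambda>d d'. NE_chain ?S d' d \<longleftrightarrow> snd d < snd d') ((c, a) # zip (rev r1) (rev us))"
    proof (rule sorted_wrt_mono_rel[rotated])
      fix d d' assume "d \<in> set ((c, a) # zip (rev r1) (rev us))" "d' \<in> set ((c, a) # zip (rev r1) (rev us))"
        and less: "fst d' < fst d"
      then have "d \<in> ?T" "d' \<in> ?T"
        unfolding T(2) by blast+
      then show "NE_chain ?S d' d \<longleftrightarrow> snd d < snd d'"
        using NE less by simp
    qed
    have disj: "\<forall>u\<in>?B. fst u \<notin> set (c # rev r1)"
      using less by (fastforce dest: set_zip_leftD)
    \<comment> \<open>The upward run is computed on lists read from \<open>c\<close> upwards;
      reversing restores the order of \<open>rs\<close>.\<close>
    have "zip (c # rev r1) (run_insert (<) l a (rev us)) =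
      rev (zip (r1 @ [c]) (rev (run_insert (<) l a (rev us))))"
      using len by (simp add: rev_zip)
    then have "set (zip (c # rev r1) (run_insert (<) l a (rev us))) \<union> ?B =
      set (zip rs (rev (run_insert (<) l a (rev us)) @ vs))"
      using len by (simp add: rs(3) zip_append[of "r1 @ [c]", simplified])
    with shift_cells_initial_run[OF _ dist(2) disj srt, of l] show ?thesis
      unfolding T(2) using len by simp
  qed
  have Da: "hd (zip (rev r1) (rev us)) = (last r1, last us)" if "us \<noteq> []"
    using that len by (cases r1 rule: rev_cases; cases us rule: rev_cases) auto
  have Db: "hd (zip r2 vs) = (hd r2, hd vs)" if "vs \<noteq> []"
    using that len by (cases r2; cases vs) auto
  have nil: "zip (rev r1) (rev us) = [] \<longleftrightarrow> us = []" "zip r2 vs = [] \<longleftrightarrow> vs = []"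
    using len by (cases r1; cases us; simp; force) (use len in \<open>cases r2; cases vs; simp\<close>)
  have no_Da: "us = [] \<or> 0 < r \<and> hd (zip (rev r1) (rev us)) = Cs ! (r - 1) \<longleftrightarrow>
      us = [] \<or> last us = a"
    using prev Da nil by auto
  \<comment> \<open>Case (a) is the downward run that consists of \<open>(c, a)\<close>
    alone.\<close>
  have single: "[(c, a)] = initial_run (\<lambda>d d'. \<not> NE_chain ?S d d') ((c, a) # zip r2 vs)" if "vs = []"
    using that by simp
  let ?no_Da = "us = [] \<or> last us = a"
  have right: "snd (hd (zip r2 vs)) < snd (hd (zip (rev r1) (rev us))) \<longleftrightarrow> hd vs < last us"
    if "us \<noteq> []" "vs \<noteq> []"
    using that Da Db by simp
  consider "?no_Da" "vs = []" | "?no_Da \<or> us \<noteq> [] \<and> hd vs < last us" "vs \<noteq> []"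
    | "\<not> ?no_Da" "vs = [] \<or> \<not> hd vs < last us"
    by blast
  then show ?thesis
  proof cases
    case 1
    then have A: "?no_Da \<and> vs = []" by blast
    have at: "tau_word_at a l us vs = us @ run_insert (\<le>) l a vs"
      unfolding tau_word_at_def by (rule if_P) (use 1 in blast)
    show ?thesis
      unfolding tau_step_def Let_def Cs fst_conv up dn no_Da nil if_P[OF A] single[OF 1(2)] at
      by (rule dn_run)
  next
    case 2
    have at: "tau_word_at a l us vs = us @ run_insert (\<le>) l a vs"
      unfolding tau_word_at_def by (rule if_P) (use 2 in blast)
    have A: "\<not> (?no_Da \<and> vs = [])"
      using 2 by blast
    have B: "?no_Da \<and> vs \<noteq> [] \<or> us \<noteq> [] \<and> vs \<noteq> [] \<and>
        snd (hd (zip r2 vs)) < snd (hd (zip (rev r1) (rev us)))"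
      using 2 right by blast
    show ?thesis
      unfolding tau_step_def Let_def Cs fst_conv up dn no_Da nil if_not_P[OF A] if_P[OF B] at
      by (rule dn_run)
  next
    case 3
    have at: "tau_word_at a l us vs = rev (run_insert (<) l a (rev us)) @ vs"
      unfolding tau_word_at_def by (rule if_not_P) (use 3 in blast)
    have A: "\<not> (?no_Da \<and> vs = [])"
      using 3 by blast
    have B: "\<not> (?no_Da \<and> vs \<noteq> [] \<or> us \<noteq> [] \<and> vs \<noteq> [] \<and>
        snd (hd (zip r2 vs)) < snd (hd (zip (rev r1) (rev us))))"
      using 3 right by blast
    show ?thesis
      unfolding tau_step_def Let_def Cs fst_conv up dn no_Da nil if_not_P[OF A] if_not_P[OF B] at
      by (rule up_run)
  qed
qed

section \<open>Iterated passes and \<open>tau\<close> on a rectangle\<close>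

lemma count_list_length_filter: "count_list w a = length (filter (\<lambda>y. y = a) w)"
  by (induction w) auto

lemma Min_Max_interval:
  fixes a b :: int
  assumes "a \<le> b"
  shows "Min {a..b} = a" "Max {a..b} = b"
  using assms by (auto intro: Min_eqI Max_eqI)

lemma filter_zip_notin: "a \<notin> set ys \<Longrightarrow> filter (\<lambda>c. snd c = a) (zip xs ys) = []"
  by (auto simp: filter_empty_conv dest: set_zip_rightD)

text \<open>The list of first-column cells is computed once, before the loop. A pass removes exactly
  the lowest remaining one from column \<open>a\<close> and leaves the others in place, so the rest
  of the list stays valid.\<close>

lemma filter_zip_tau_word:
  assumes "tau_admissible a l w" "a \<in> set w" "length (rs :: int list) = length w"
  shows "filter (\<lambda>c. snd c = a) (zip rs (tau_word a l w)) = butlast (filter (\<lambda>c. snd c = a) (zip rs w))"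
proof -
  let ?F = "filter (\<lambda>c. snd c = a)"
  have one: "\<exists>c. ?F (zip r (p @ a # q)) = [c]"
    if pq: "a \<notin> set (p @ q)" "length r = length (p @ a # q)" for p q :: "int list" and r :: "int list"
  proof -
    have "length p < length r"
      using pq(2) by simp
    then have "r = take (length p) r @ r ! length p # drop (Suc (length p)) r"
      by (rule id_take_nth_drop)
    then obtain r1 c r2 where "r = r1 @ c # r2" "length r1 = length p"
      using \<open>length p < length r\<close> by (metis length_take min.absorb4)
    then show ?thesis
      using pq by (simp add: filter_zip_notin)
  qed
  have main: "?F (zip rs (u @ v')) = butlast (?F (zip rs (u @ p @ a # q)))"
    if "length v' = length (p @ a # q)" "a \<notin> set (v' @ p @ q)" "length rs = length (u @ p @ a # q)"
    for u p q v' :: "int list"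
  proof -
    let ?r = "drop (length u) rs"
    have "a \<notin> set (p @ q)" "length ?r = length (p @ a # q)"
      using that(2,3) by auto
    then obtain c where "?F (zip ?r (p @ a # q)) = [c]"
      using one by blast
    moreover have "?F (zip ?r v') = []"
      using that(2) by (simp add: filter_zip_notin)
    ultimately show ?thesis
      by (simp add: zip_append2 butlast_append)
  qed
  have "a \<noteq> l"
    using assms(1) by (simp add: tau_admissible_def)
  from assms(1,2) show ?thesis
  proof (cases rule: tau_word_cases)
    case (down us v1 v2)
    show ?thesis
      unfolding down(2) using main[of "v1 @ l # v2" "[]" "v1 @ v2" us] down(1,3) assms(3) \<open>a \<noteq> l\<close>
      by simp
  next
    case (up u1 u2 vs)
    show ?thesis
      unfolding up(2) using main[of "l # u2 @ vs" u2 vs u1] up(1,3) assms(3) \<open>a \<noteq> l\<close>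
      by simp
  qed
qed

text \<open>Invariant of the loop: the cells now in column \<open>a\<close> are the entries of
  \<open>Cs\<close> with index at most \<open>r\<close>, in order. The second claim re-establishes
  it for the next smaller index.\<close>

lemma tau_step_tau_word:
  assumes "connected_int H" "sorted_wrt (<) rs" "set rs \<subseteq> H" "length rs = length w"
    and adm: "tau_admissible a l w"
    and Cs: "filter (\<lambda>c. snd c = a) (zip rs w) = take (Suc r) Cs" "r < length Cs"
  shows "tau_step (H \<times> {a..l}) l Cs r (set (zip rs w)) = set (zip rs (tau_word a l w))"
    and "filter (\<lambda>c. snd c = a) (zip rs (tau_word a l w)) = take r Cs"
proof -
  let ?F = "filter (\<lambda>c. snd c = a)"
  have "?F (zip rs w) \<noteq> []"
    using Cs by auto
  then have a: "a \<in> set w"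
    using filter_zip_notin by metis
  obtain us vs where w: "w = us @ a # vs" "a \<notin> set vs"
    using tau_admissible_split[OF adm a] by blast
  define r1 where "r1 = take (length us) rs"
  define c where "c = rs ! length us"
  define r2 where "r2 = drop (Suc (length us)) rs"
  have rs: "rs = r1 @ c # r2" "length r1 = length us" "length r2 = length vs"
    using assms(4) w(1) by (auto simp: r1_def c_def r2_def id_take_nth_drop)
  have "?F (zip rs w) = ?F (zip r1 us) @ [(c, a)]"
    using rs w by (simp add: filter_zip_notin)
  then have F: "take r Cs = ?F (zip r1 us)" "Cs ! r = (c, a)"
    using Cs by (simp_all add: take_Suc_conv_app_nth)
  \<comment> \<open>The cell directly above lies in column \<open>a\<close> iff it is the last entry
    of \<open>take r Cs\<close>.\<close>
  have "0 < r \<and> (last r1, last us) = Cs ! (r - 1) \<longleftrightarrow> last us = a" if us_ne: "us \<noteq> []"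
  proof
    assume *: "0 < r \<and> (last r1, last us) = Cs ! (r - 1)"
    then have "Cs ! (r - 1) \<in> set (take r Cs)"
      using Cs(2) nth_mem[of "r - 1" "take r Cs"] by simp
    then have "(last r1, last us) \<in> set (?F (zip r1 us))"
      using * F(1) by metis
    then show "last us = a" by simp
  next
    assume "last us = a"
    moreover obtain us' x where us: "us = us' @ [x]"
      using us_ne by (cases us rule: rev_cases) auto
    moreover obtain r' y where r': "r1 = r' @ [y]"
      using us rs(2) by (cases r1 rule: rev_cases) auto
    moreover from us r' rs(2) have "length us' = length r'" by simp
    ultimately have "take r Cs = ?F (zip r' us') @ [(last r1, last us)]"
      using F(1) by simp
    then have "take r Cs \<noteq> []" "last (take r Cs) = (last r1, last us)"
      by simp_all
    then show "0 < r \<and> (last r1, last us) = Cs ! (r - 1)"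
      using Cs(2) last_conv_nth[of "take r Cs"] by auto
  qed
  then show "tau_step (H \<times> {a..l}) l Cs r (set (zip rs w)) = set (zip rs (tau_word a l w))"
    using tau_step_eq[OF assms(1-3) rs(1) _ w(1) rs(2,3) F(2)] adm w
    by (simp add: tau_word_append tau_admissible_def)
  show "?F (zip rs (tau_word a l w)) = take r Cs"
    using filter_zip_tau_word[OF adm a assms(4)] Cs by (simp add: butlast_take)
qed

lemma zip_rows_word: "zip (map fst (ones T)) (word T) = ones T"
  by (simp add: word_def zip_map_fst_snd)

lemma set_word: "row_filling T \<Longrightarrow> set (word T) = cols T"
  by (simp add: word_def set_ones cols_def)

lemma count_list_word: "row_filling T \<Longrightarrow> count_list (word T) j = card (col_of T j)"
proof -
  assume T: "row_filling T"
  have "count_list (word T) j = length (filter (\<lambda>c. snd c = j) (ones T))"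
    by (simp add: word_def count_list_length_filter filter_map o_def)
  also have "\<dots> = card (set (map fst (filter (\<lambda>c. snd c = j) (ones T))))"
    using sorted_ones[OF T]
    by (subst distinct_card) (auto simp: strict_sorted_iff distinct_map intro: inj_on_subset)
  also have "set (map fst (filter (\<lambda>c. snd c = j) (ones T))) = col_of T j"
    using set_ones[OF T] by (force simp: col_of_def)
  finally show ?thesis .
qed

text \<open>The loop index falls from the end of \<open>Cs\<close> while \<open>k\<close> counts the
  completed passes, hence the reversed interval that starts at \<open>length Cs - k\<close>.\<close>

lemma tau_word_fold:
  assumes "connected_int H" "sorted_wrt (<) rs" "set rs \<subseteq> H" "length rs = length w"
    and "tau_admissible a l w" and "k \<le> count_list w a"
  defines "Cs \<equiv> filter (\<lambda>c. snd c = a) (zip rs w)"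
  shows "fold (tau_step (H \<times> {a..l}) l Cs) (rev [length Cs - k..<length Cs]) (set (zip rs w)) =
      set (zip rs ((tau_word a l ^^ k) w)) \<and>
    filter (\<lambda>c. snd c = a) (zip rs ((tau_word a l ^^ k) w)) = take (length Cs - k) Cs"
  using assms(6)
proof (induction k)
  case 0
  then show ?case by (simp add: Cs_def)
next
  case (Suc k)
  have "length Cs = count_list w a"
  proof -
    have "length Cs = length (filter (\<lambda>y. y = a) (map snd (zip rs w)))"
      by (simp add: Cs_def filter_map o_def)
    then show ?thesis
      using assms(4) by (simp add: count_list_length_filter)
  qed
  then have n: "length Cs - k = Suc (length Cs - Suc k)" "length Cs - Suc k < length Cs"
    using Suc.prems by auto
  let ?w = "(tau_word a l ^^ k) w"
  have "same_des w ?w" "tau_admissible a l ?w"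
    using tau_word_iterate(1,3)[OF assms(5)] Suc.prems by auto
  then have "length rs = length ?w"
    using assms(4) by (simp add: same_des_def)
  moreover have "filter (\<lambda>c. snd c = a) (zip rs ?w) = take (Suc (length Cs - Suc k)) Cs"
    using Suc n by simp
  ultimately have "tau_step (H \<times> {a..l}) l Cs (length Cs - Suc k) (set (zip rs ?w)) =
        set (zip rs (tau_word a l ?w))"
      "filter (\<lambda>c. snd c = a) (zip rs (tau_word a l ?w)) = take (length Cs - Suc k) Cs"
    using tau_step_tau_word[OF assms(1-3) _ \<open>tau_admissible a l ?w\<close> _ n(2)] by auto
  moreover have "rev [length Cs - Suc k..<length Cs] =
      rev [length Cs - k..<length Cs] @ [length Cs - Suc k]"
    using n by (simp add: upt_conv_Cons)
  moreover have "fold (tau_step (H \<times> {a..l}) l Cs) (rev [length Cs - k..<length Cs]) (set (zip rs w)) =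
      set (zip rs ?w)"
    using Suc by simp
  ultimately show ?case
    by simp
qed

text \<open>\<open>b + 1\<close> is the added column; the decrement renumbers the columns after the
  deletion of column \<open>a\<close>, so the inserted letters end up in column
  \<open>b\<close>.\<close>

definition tau_columns :: "int \<Rightarrow> int \<Rightarrow> int list \<Rightarrow> int list" where
  "tau_columns a b w = map (\<lambda>j. j - 1) ((tau_word a (b + 1) ^^ count_list w a) w)"

lemma rows_cols_box:
  "J \<noteq> {} \<Longrightarrow> rows (H \<times> J) = H" "H \<noteq> {} \<Longrightarrow> cols (H \<times> J) = J"
  by (auto simp: rows_def cols_def)

text \<open>The letter \<open>b + 1\<close> does not occur yet, so the whole word can serve as the
  upper part.\<close>

lemma tau_admissible_start:
  "a \<le> b \<Longrightarrow> set w \<subseteq> {a..b} \<Longrightarrow> tau_admissible a (b + 1) w"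
  unfolding tau_admissible_def by (intro conjI exI[of _ w] exI[of _ "[]"]) auto

lemma tau_eq:
  assumes "connected_int H" "H \<noteq> {}" "a \<le> b" "row_filling T" "T \<subseteq> H \<times> {a..b}"
  shows "tau (H \<times> {a..b}) T = set (zip (map fst (ones T)) (tau_columns a b (word T)))"
proof -
  let ?rs = "map fst (ones T)" and ?w = "word T"
  define w' where "w' = (tau_word a (b + 1) ^^ count_list ?w a) ?w"
  have cols: "cols (H \<times> {a..b}) = {a..b}" "rows (H \<times> {a..b}) = H"
    using assms(2,3) by (simp_all add: rows_cols_box)
  have S: "H \<times> {a..b} \<union> H \<times> {b + 1} = H \<times> {a..b + 1}"
    using assms(3) by auto
  have w: "set ?w \<subseteq> {a..b}"
    using assms(5) by (auto simp: set_word[OF assms(4)] cols_def)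
  have adm: "tau_admissible a (b + 1) ?w"
    using assms(3) w by (rule tau_admissible_start)
  have rs: "sorted_wrt (<) ?rs" "set ?rs \<subseteq> H" "length ?rs = length ?w"
    using sorted_ones[OF assms(4)] assms(5) by (auto simp: set_ones[OF assms(4)] word_def)
  have Cs: "ones {c \<in> T. snd c = a} = filter (\<lambda>c. snd c = a) (zip ?rs ?w)"
    by (simp add: ones_filter[OF assms(4)] zip_rows_word)
  have T: "set (zip ?rs ?w) = T"
    by (simp add: zip_rows_word set_ones[OF assms(4)])
  define Cs where "Cs = filter (\<lambda>c. snd c = a) (zip ?rs ?w)"
  have "length Cs = count_list ?w a"
    unfolding Cs_def zip_rows_word
    by (simp add: word_def count_list_length_filter filter_map o_def)
  then have fold: "fold (tau_step (H \<times> {a..b + 1}) (b + 1) Cs) (rev [0..<length Cs]) T = set (zip ?rs w')"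
    using tau_word_fold[OF assms(1) rs adm order_refl] unfolding Cs_def[symmetric] T w'_def by simp
  \<comment> \<open>All letters \<open>a\<close> have been consumed, so deleting the first column
    discards no 1-cell.\<close>
  have "count_list w' a = 0"
    using tau_word_iterate(2)[OF adm order_refl, of a] assms(3) by (simp add: w'_def)
  then have "a \<notin> set w'"
    by (simp add: count_list_0_iff)
  then have "{c \<in> set (zip ?rs w'). snd c \<noteq> a} = set (zip ?rs w')"
    by (auto dest: set_zip_rightD)
  then have "tau (H \<times> {a..b}) T = (\<lambda>(i, j). (i, j - 1)) ` set (zip ?rs w')"
    using fold S by (simp add: tau_def Let_def cols Min_Max_interval[OF assms(3)] Cs flip: Cs_def)
  also have "\<dots> = set (zip ?rs (tau_columns a b ?w))"
    by (simp add: tau_columns_def w'_def zip_map2 case_prod_unfold flip: set_map)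
  finally show ?thesis .
qed

lemma tau_columns_properties:
  assumes "a \<le> b" "set w \<subseteq> {a..b}"
  shows "same_des w (tau_columns a b w)"
    and "set (tau_columns a b w) \<subseteq> {a..b}"
    and "a \<notin> J \<Longrightarrow> b + 1 \<notin> J \<Longrightarrow>
      filter (\<lambda>j. j + 1 \<in> J) (tau_columns a b w) = map (\<lambda>j. j - 1) (filter (\<lambda>j. j \<in> J) w)"
    and "count_list (tau_columns a b w) b = count_list w a"
    and "j \<in> {a..<b} \<Longrightarrow> count_list (tau_columns a b w) j = count_list w (j + 1)"
proof -
  let ?n = "count_list w a"
  let ?w = "(tau_word a (b + 1) ^^ ?n) w"
  note it = tau_word_iterate[OF tau_admissible_start[OF assms] order_refl]
  have count: "count_list (tau_columns a b w) j = count_list ?w (j + 1)" for j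
  proof -
    have "count_list (map (\<lambda>j. j - 1) v) j = count_list v (j + 1)" for v :: "int list"
      by (induction v) auto
    then show ?thesis by (simp add: tau_columns_def)
  qed
  show "same_des w (tau_columns a b w)"
    using it(3) by (auto simp: same_des_def tau_columns_def)
  have "count_list ?w a = 0"
    using it(2)[of a] assms(1) by simp
  then have "a \<notin> set ?w"
    by (simp add: count_list_0_iff)
  moreover have "set ?w \<subseteq> {a..b + 1}"
    using it(1) by (simp add: tau_admissible_def)
  ultimately have "a \<noteq> x \<and> a \<le> x \<and> x \<le> b + 1" if "x \<in> set ?w" for x
    using that by auto
  then show "set (tau_columns a b w) \<subseteq> {a..b}"
    by (force simp: tau_columns_def)
  show "filter (\<lambda>j. j + 1 \<in> J) (tau_columns a b w) = map (\<lambda>j. j - 1) (filter (\<lambda>j. j \<in> J) w)"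
    if "a \<notin> J" "b + 1 \<notin> J"
    using it(4)[of "\<lambda>j. j \<in> J"] that by (simp add: tau_columns_def filter_map o_def)
  have "b + 1 \<notin> set w"
    using assms(2) by auto
  then show "count_list (tau_columns a b w) b = count_list w a"
    using it(2)[of "b + 1"] assms(1) by (simp add: count)
  show "count_list (tau_columns a b w) j = count_list w (j + 1)" if "j \<in> {a..<b}"
    using it(2)[of "j + 1"] that by (simp add: count)
qed

lemma tau_columns_inj:
  assumes "a \<le> b" "set v \<subseteq> {a..b}" "set w \<subseteq> {a..b}" "count_list v a = count_list w a"
    and "tau_columns a b v = tau_columns a b w"
  shows "v = w"
proof -
  have "inj (\<lambda>j :: int. j - 1)"
    by (simp add: inj_def)
  then have "(tau_word a (b + 1) ^^ count_list v a) v = (tau_word a (b + 1) ^^ count_list v a) w"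
    using assms(4,5) by (simp add: tau_columns_def)
  then show ?thesis
    using tau_word_iterate_inj[OF tau_admissible_start[OF assms(1,2)] tau_admissible_start[OF assms(1,3)]
      order_refl] assms(4)
    by simp
qed

lemma
  assumes "connected_int H" "H \<noteq> {}" "a \<le> b" "row_filling T" "T \<subseteq> H \<times> {a..b}"
  shows row_filling_tau: "row_filling (tau (H \<times> {a..b}) T)"
    and fst_ones_tau: "map fst (ones (tau (H \<times> {a..b}) T)) = map fst (ones T)"
    and rows_tau: "rows (tau (H \<times> {a..b}) T) = rows T"
    and word_tau: "word (tau (H \<times> {a..b}) T) = tau_columns a b (word T)"
    and tau_subset: "tau (H \<times> {a..b}) T \<subseteq> H \<times> {a..b}"
    and des_rows_tau: "des_rows (tau (H \<times> {a..b}) T) = des_rows T"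
proof -
  let ?rs = "map fst (ones T)"
  have w: "set (word T) \<subseteq> {a..b}"
    using assms(5) by (auto simp: set_word[OF assms(4)] cols_def)
  note tc = tau_columns_properties[OF assms(3) w]
  have len: "length ?rs = length (tau_columns a b (word T))"
    using tc(1) by (simp add: same_des_def word_def)
  note eq = tau_eq[OF assms]
  note z = ones_zip[OF sorted_ones[OF assms(4)] len, folded eq]
  show rf: "row_filling (tau (H \<times> {a..b}) T)"
    by (rule z(2))
  show fst: "map fst (ones (tau (H \<times> {a..b}) T)) = ?rs"
    unfolding z(1) using len by (rule map_fst_zip)
  show rows: "rows (tau (H \<times> {a..b}) T) = rows T"
    using arg_cong[OF fst, of set] by (simp add: rows_def set_ones rf assms(4))
  show word: "word (tau (H \<times> {a..b}) T) = tau_columns a b (word T)"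
    unfolding word_def z(1) using len by (simp add: map_snd_zip word_def)
  show "tau (H \<times> {a..b}) T \<subseteq> H \<times> {a..b}"
  proof
    fix c assume "c \<in> tau (H \<times> {a..b}) T"
    then have "fst c \<in> rows T" "snd c \<in> set (tau_columns a b (word T))"
      using rows set_zip_rightD[of "fst c" "snd c"] unfolding eq rows_def by auto
    then show "c \<in> H \<times> {a..b}"
      using tc(2) assms(5) by (auto simp: rows_def mem_Times_iff)
  qed
  show "des_rows (tau (H \<times> {a..b}) T) = des_rows T"
    using same_des_word_iff[OF assms(4) rf rows[symmetric]] tc(1) by (simp add: word)
qed

text \<open>The nonempty rows survive \<open>tau\<close> and the word is recovered by undoing the
  passes; equal counts in column \<open>a\<close> make the numbers of passes agree.\<close>

lemma tau_inj:
  assumes "connected_int H" "H \<noteq> {}" "a \<le> b" "row_filling T" "T \<subseteq> H \<times> {a..b}"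
    and "row_filling U" "U \<subseteq> H \<times> {a..b}" "card (col_of T a) = card (col_of U a)"
    and eq: "tau (H \<times> {a..b}) T = tau (H \<times> {a..b}) U"
  shows "T = U"
proof -
  note T = assms(1-5) and U = assms(1-3,6,7)
  have "map fst (ones T) = map fst (ones U)"
    using fst_ones_tau[OF T] fst_ones_tau[OF U] eq by simp
  moreover have "tau_columns a b (word T) = tau_columns a b (word U)"
    using word_tau[OF T] word_tau[OF U] eq by simp
  moreover have "set (word T) \<subseteq> {a..b}" "set (word U) \<subseteq> {a..b}"
    using assms(5,7) by (auto simp: set_word assms(4,6) cols_def)
  ultimately have "ones T = ones U"
    using tau_columns_inj[of a b "word T" "word U"] assms(3,4,6,8) zip_rows_word
    by (metis count_list_word)
  then show ?thesis
    using set_ones assms(4,6) by metis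
qed

section \<open>Maximal rectangles of moon polyominoes\<close>

text \<open>Two rows, each with a column missing from the other, would yield two incomparable
  columns.\<close>

lemma moon_row_nested:
  assumes "moon_polyomino P"
  shows "row_of P i \<subseteq> row_of P i' \<or> row_of P i' \<subseteq> row_of P i"
proof (rule ccontr)
  assume "\<not> ?thesis"
  then obtain j j' where j: "(i, j) \<in> P" "(i', j) \<notin> P" "(i', j') \<in> P" "(i, j') \<notin> P"
    by (auto simp: row_of_def)
  then have "j \<in> cols P" "j' \<in> cols P"
    by (force simp: cols_def)+
  then have "col_of P j \<subseteq> col_of P j' \<or> col_of P j' \<subseteq> col_of P j"
    using assms by (simp add: moon_polyomino_def intersection_free_def)
  then show False
    using j by (auto simp: col_of_def)
qed

lemma row_of_image_snd: "row_of P i = snd ` (P \<inter> {i} \<times> UNIV)"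
  by (force simp: row_of_def)

lemma col_of_image_fst: "col_of P j = fst ` (P \<inter> UNIV \<times> {j})"
  by (force simp: col_of_def)

lemma finite_row_of: "finite P \<Longrightarrow> finite (row_of P i)"
  by (simp add: row_of_image_snd)

lemma finite_col_of: "finite P \<Longrightarrow> finite (col_of P j)"
  by (simp add: col_of_image_fst)

lemma row_of_subset_cols: "row_of P i \<subseteq> cols P"
  by (force simp: row_of_def cols_def)

lemma in_rows_iff: "i \<in> rows P \<longleftrightarrow> row_of P i \<noteq> {}"
  by (auto simp: rows_def row_of_def image_iff Bex_def)

lemma in_cols_iff: "j \<in> cols P \<longleftrightarrow> col_of P j \<noteq> {}"
  by (auto simp: cols_def col_of_def image_iff Bex_def)

lemma finite_connected_int:
  assumes "finite K" "K \<noteq> {}" "connected_int K"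
  shows "K = {Min K..Max K}"
proof
  show "K \<subseteq> {Min K..Max K}"
    using assms(1) by auto
  have "Min K \<in> K" "Max K \<in> K"
    using assms(1,2) by simp_all
  then show "{Min K..Max K} \<subseteq> K"
    using assms(3) unfolding connected_int_def by blast
qed

text \<open>By nestedness some row reaches both the leftmost and the rightmost column, and this row
  is an interval. So the index of a column is its distance from the leftmost one.\<close>

lemma moon_cols:
  assumes "moon_polyomino P" "P \<noteq> {}"
  shows "cols P = {Min (cols P)..Max (cols P)}"
proof
  have fin: "finite (cols P)" "cols P \<noteq> {}"
    using assms by (auto simp: cols_def moon_polyomino_def)
  then show "cols P \<subseteq> {Min (cols P)..Max (cols P)}"
    by auto
  have "Min (cols P) \<in> cols P" "Max (cols P) \<in> cols P"
    using fin by simp_all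
  then obtain i i' where "Min (cols P) \<in> row_of P i" "Max (cols P) \<in> row_of P i'"
    by (auto simp: cols_def row_of_def)
  then obtain k where "Min (cols P) \<in> row_of P k" "Max (cols P) \<in> row_of P k"
    using moon_row_nested[OF assms(1)] by blast
  then have "{Min (cols P)..Max (cols P)} \<subseteq> row_of P k"
    using assms(1) unfolding moon_polyomino_def convex_polyomino_def connected_int_def by blast
  then show "{Min (cols P)..Max (cols P)} \<subseteq> cols P"
    using row_of_subset_cols by blast
qed

text \<open>Each maximal rectangle of a moon polyomino is the one spanned by its shortest row.\<close>

definition spanned_rect :: "cell set \<Rightarrow> int \<Rightarrow> cell set" where
  "spanned_rect P i = {i'. row_of P i \<subseteq> row_of P i'} \<times> row_of P i"

lemma spanned_rect_subset: "spanned_rect P i \<subseteq> P"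
  by (auto simp: spanned_rect_def row_of_def)

text \<open>For each \<open>j\<close> in row \<open>i\<close>, the rows meeting column
  \<open>j\<close> form an interval; the spanning rows are the intersection of these.\<close>

lemma connected_spanning_rows:
  assumes "moon_polyomino P"
  shows "connected_int {i'. row_of P i \<subseteq> row_of P i'}"
  unfolding connected_int_def
proof (intro ballI subsetI CollectI)
  fix i1 i2 k j
  assume *: "i1 \<in> {i'. row_of P i \<subseteq> row_of P i'}" "i2 \<in> {i'. row_of P i \<subseteq> row_of P i'}"
    "k \<in> {i1..i2}" "j \<in> row_of P i"
  then have "i1 \<in> col_of P j" "i2 \<in> col_of P j"
    by (auto simp: row_of_def col_of_def)
  moreover have "connected_int (col_of P j)"
    using assms by (simp add: moon_polyomino_def convex_polyomino_def)
  ultimately have "k \<in> col_of P j"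
    using *(3) unfolding connected_int_def by blast
  then show "j \<in> row_of P k"
    by (simp add: row_of_def col_of_def)
qed

lemma moon_connected_row: "moon_polyomino P \<Longrightarrow> connected_int (row_of P i)"
  by (simp add: moon_polyomino_def convex_polyomino_def)

lemma moon_connected_col: "moon_polyomino P \<Longrightarrow> connected_int (col_of P j)"
  by (simp add: moon_polyomino_def convex_polyomino_def)

lemma finite_spanning_rows: "finite P \<Longrightarrow> i \<in> rows P \<Longrightarrow> finite {i'. row_of P i \<subseteq> row_of P i'}"
proof -
  assume "finite P" "i \<in> rows P"
  then have "{i'. row_of P i \<subseteq> row_of P i'} \<subseteq> rows P"
    by (auto simp: in_rows_iff)
  then show ?thesis
    using \<open>finite P\<close> finite_subset unfolding rows_def by blast
qed

lemma rectangle_box: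
  assumes "finite K" "K \<noteq> {}" "connected_int K" "finite J" "J \<noteq> {}" "connected_int J"
  shows "rectangle (K \<times> J)"
  unfolding rectangle_def
proof (intro exI conjI)
  show "K \<times> J = {Min K..Max K} \<times> {Min J..Max J}"
    using finite_connected_int[OF assms(1-3)] finite_connected_int[OF assms(4-6)] by simp
qed (use assms in auto)

lemma rectangle_spanned_rect:
  assumes "moon_polyomino P" "i \<in> rows P"
  shows "rectangle (spanned_rect P i)"
  unfolding spanned_rect_def
  using assms finite_spanning_rows[of P i]
  by (intro rectangle_box connected_spanning_rows moon_connected_row)
    (auto simp: moon_polyomino_def in_rows_iff finite_row_of)

text \<open>For nested finite sets, minimal cardinality means minimality under inclusion.\<close>

lemma shortest_row:
  assumes "moon_polyomino P" "finite K" "K \<noteq> {}"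
  obtains i where "i \<in> K" "\<And>i'. i' \<in> K \<Longrightarrow> row_of P i \<subseteq> row_of P i'"
proof -
  obtain i where i: "i \<in> K" "\<And>i'. i' \<in> K \<Longrightarrow> card (row_of P i) \<le> card (row_of P i')"
    using ex_is_arg_min_if_finite[OF assms(2,3), of "\<lambda>i. card (row_of P i)"]
    by (auto simp: is_arg_min_linorder)
  have "row_of P i \<subseteq> row_of P i'" if "i' \<in> K" for i'
  proof -
    have "finite (row_of P i)"
      using assms(1) by (simp add: moon_polyomino_def finite_row_of)
    then show ?thesis
      using i(2)[OF that] moon_row_nested[OF assms(1), of i i'] card_seteq by blast
  qed
  with i(1) show thesis using that by blast
qed

text \<open>A rectangle lies in the one spanned by the shortest of its rows in \<open>P\<close>.
  Conversely, a rectangle containing the one spanned by row \<open>i\<close> contains all of row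
  \<open>i\<close>, so it has no further column and then no further row.\<close>

lemma maximal_rectangles_moon:
  assumes "moon_polyomino P"
  shows "maximal_rectangles P = spanned_rect P ` rows P"
proof (intro equalityI subsetI)
  fix Q assume Q: "Q \<in> maximal_rectangles P"
  then obtain i i' j j' where "i \<le> i'" "j \<le> j'" "Q = {i..i'} \<times> {j..j'}"
    by (auto simp: maximal_rectangles_def rectangle_def)
  then obtain K J where KJ: "Q = K \<times> J" "finite K" "K \<noteq> {}" "J \<noteq> {}"
    by force
  have "Q \<subseteq> P"
    using Q by (simp add: maximal_rectangles_def)
  obtain i where i: "i \<in> K" "\<And>i'. i' \<in> K \<Longrightarrow> row_of P i \<subseteq> row_of P i'"
    using shortest_row[OF assms KJ(2,3)] by blast
  then have "i \<in> rows P"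
    using KJ \<open>Q \<subseteq> P\<close> by (force simp: rows_def)
  moreover have "Q \<subseteq> spanned_rect P i"
    using i KJ(1) \<open>Q \<subseteq> P\<close> by (auto simp: spanned_rect_def row_of_def)
  ultimately have "spanned_rect P i = Q"
    using Q rectangle_spanned_rect[OF assms, of i] spanned_rect_subset[of P i]
    by (auto simp: maximal_rectangles_def)
  then show "Q \<in> spanned_rect P ` rows P"
    using \<open>i \<in> rows P\<close> by blast
next
  fix Q assume "Q \<in> spanned_rect P ` rows P"
  then obtain i where i: "i \<in> rows P" and Q: "Q = spanned_rect P i"
    by blast
  have "R' = Q" if "rectangle R'" "R' \<subseteq> P" "Q \<subseteq> R'" for R'
  proof
    obtain K J where R': "R' = K \<times> J"
      using \<open>rectangle R'\<close> by (auto simp: rectangle_def)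
    have "{i'. row_of P i \<subseteq> row_of P i'} \<times> row_of P i \<subseteq> K \<times> J" "row_of P i \<noteq> {}"
      using that(3) i by (simp_all add: Q R' spanned_rect_def in_rows_iff)
    then have "i \<in> K" "row_of P i \<subseteq> J"
      by blast+
    moreover have "J \<subseteq> row_of P k" if "k \<in> K" for k
      using that \<open>R' \<subseteq> P\<close> R' by (auto simp: row_of_def)
    ultimately show "R' \<subseteq> Q"
      unfolding Q R' spanned_rect_def by blast
  qed (rule that)
  then show "Q \<in> maximal_rectangles P"
    using rectangle_spanned_rect[OF assms i] spanned_rect_subset[of P i]
    by (simp add: maximal_rectangles_def Q)
qed

lemma rows_spanned_rect: "i \<in> rows P \<Longrightarrow> rows (spanned_rect P i) = {i'. row_of P i \<subseteq> row_of P i'}"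
  by (simp add: spanned_rect_def rows_cols_box in_rows_iff)

text \<open>Nested rows give nested row sets of the spanned rectangles; equal heights then force
  equal row sets, hence equal spanning rows. This makes sorting by height well defined.\<close>

lemma inj_on_height_maximal_rectangles:
  assumes "moon_polyomino P"
  shows "inj_on (\<lambda>R. card (rows R)) (maximal_rectangles P)"
proof -
  have *: "spanned_rect P i = spanned_rect P k"
    if "i \<in> rows P" "k \<in> rows P" "row_of P i \<subseteq> row_of P k"
      "card (rows (spanned_rect P i)) = card (rows (spanned_rect P k))" for i k
  proof -
    have "{i'. row_of P k \<subseteq> row_of P i'} \<subseteq> {i'. row_of P i \<subseteq> row_of P i'}"
      using that(3) by blast
    moreover have "finite {i'. row_of P i \<subseteq> row_of P i'}"
      using assms that(1) by (simp add: moon_polyomino_def finite_spanning_rows)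
    ultimately have "{i'. row_of P k \<subseteq> row_of P i'} = {i'. row_of P i \<subseteq> row_of P i'}"
      using that(4) by (intro card_seteq) (simp_all add: rows_spanned_rect that(1,2))
    then have "row_of P k \<subseteq> row_of P i"
      by blast
    with that(3) have "row_of P i = row_of P k"
      by blast
    then show ?thesis
      by (simp add: spanned_rect_def)
  qed
  show ?thesis
    unfolding maximal_rectangles_moon[OF assms]
  proof (rule inj_onI, elim imageE)
    fix Q R i k
    assume "card (rows Q) = card (rows R)" "Q = spanned_rect P i" "i \<in> rows P"
      "R = spanned_rect P k" "k \<in> rows P"
    then show "Q = R"
      using *[of i k] *[of k i] moon_row_nested[OF assms, of i k] by auto
  qed
qed

section \<open>The cyclic rotation of the columns \<open>a..b\<close>\<close>

definition rotate_col :: "int \<Rightarrow> int \<Rightarrow> int \<Rightarrow> int" where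
  "rotate_col a b j = (if j = a then b else if a < j \<and> j \<le> b then j - 1 else j)"

lemma bij_rotate_col: "a \<le> b \<Longrightarrow> bij (rotate_col a b)"
  by (rule o_bij[of "\<lambda>j. if j = b then a else if a \<le> j \<and> j < b then j + 1 else j"])
    (auto simp: rotate_col_def fun_eq_iff)

lemma rotate_col_image_interval: "a \<le> b \<Longrightarrow> rotate_col a b ` {a..b} = {a..b}"
proof
  assume "a \<le> b"
  then show "{a..b} \<subseteq> rotate_col a b ` {a..b}"
    by (intro subsetI, rename_tac j, case_tac "j = b")
      (auto simp: rotate_col_def image_iff intro: bexI[of _ "_ + 1"] bexI[of _ a])
qed (auto simp: rotate_col_def)

text \<open>The rotation permutes \<open>{a..b}\<close> and fixes every other column.\<close>

lemma rotate_col_image_superset: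
  assumes "a \<le> b" "{a..b} \<subseteq> J"
  shows "rotate_col a b ` J = J"
proof -
  have "J = {a..b} \<union> (J - {a..b})"
    using assms(2) by blast
  moreover have "rotate_col a b ` (J - {a..b}) = (\<lambda>j. j) ` (J - {a..b})"
    using assms(1) by (intro image_cong) (auto simp: rotate_col_def)
  ultimately show ?thesis
    using rotate_col_image_interval[OF assms(1)] by (metis image_Un image_ident)
qed

lemma rotate_col_image_subset: "J \<subseteq> {a<..b} \<Longrightarrow> rotate_col a b ` J = (\<lambda>j. j - 1) ` J"
  by (intro image_cong) (auto simp: rotate_col_def)

lemma move_col_box:
  "H \<noteq> {} \<Longrightarrow> a \<le> b \<Longrightarrow> move_col (H \<times> {a..b}) = map_prod id (rotate_col a b)"
  by (auto simp: move_col_def Let_def rows_cols_box Min_Max_interval rotate_col_def fun_eq_iff)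

lemma row_of_map_prod: "row_of (map_prod id f ` T) i = f ` row_of T i"
  by (force simp: row_of_def)

lemma col_of_map_prod: "inj f \<Longrightarrow> col_of (map_prod id f ` T) (f j) = col_of T j"
  by (force simp: col_of_def dest: injD)

lemma rows_map_prod: "rows (map_prod id f ` T) = rows T"
  by (simp add: rows_def image_image)

lemma cols_map_prod: "cols (map_prod id f ` T) = f ` cols T"
  by (simp add: cols_def image_image)

section \<open>One step of \<open>\<alpha>\<close>\<close>

lemma same_des_map_pred: "same_des w (map (\<lambda>j. j - 1) w)"
  by (simp add: same_des_def)

lemma word_pred:
  assumes "row_filling T"
  shows "row_filling (map_prod id (\<lambda>j. j - 1) ` T)"
    and "word (map_prod id (\<lambda>j. j - 1) ` T) = map (\<lambda>j. j - 1) (word T)"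
proof -
  let ?p = "map_prod id (\<lambda>j. j - 1) :: cell \<Rightarrow> cell"
  show "row_filling (?p ` T)"
    using assms by (auto simp: row_filling_def inj_on_def)
  have "ones (?p ` T) = map ?p (ones T)"
  proof (rule ones_eqI)
    have "map fst (map ?p (ones T)) = map fst (ones T)"
      by simp
    then show "sorted_wrt (<) (map fst (map ?p (ones T)))"
      using sorted_ones[OF assms] by metis
  qed (simp add: set_ones[OF assms])
  then show "word (?p ` T) = map (\<lambda>j. j - 1) (word T)"
    by (simp add: word_def)
qed

lemma connected_int_pred: "connected_int J \<Longrightarrow> connected_int ((\<lambda>j. j - 1) ` J)"
  unfolding connected_int_def
proof (intro ballI subsetI)
  fix x y z
  assume J: "\<forall>a\<in>J. \<forall>b\<in>J. {a..b} \<subseteq> J" and "x \<in> (\<lambda>j. j - 1) ` J" "y \<in> (\<lambda>j. j - 1) ` J" "z \<in> {x..y}"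
  then obtain x' y' where "x' \<in> J" "y' \<in> J" "z + 1 \<in> {x'..y'}"
    by (auto simp del: atLeastAtMost_iff) (auto simp: algebra_simps)
  then have "z + 1 \<in> J"
    using J by blast
  then show "z \<in> (\<lambda>j. j - 1) ` J"
    by (rule image_eqI[rotated]) simp
qed

text \<open>\<open>V\<close> and \<open>W\<close> stand for the two fillings of the left rectangle,
  \<open>X\<close> for cells to its right. A consecutive pair with exactly one cell in
  \<open>X\<close> is a descent iff the upper cell is in \<open>X\<close>, whatever column the other
  one has; a pair inside the rectangle is covered by the hypothesis. One inclusion suffices because
  the hypotheses are symmetric in \<open>V\<close> and \<open>W\<close>.\<close>

lemma des_rows_union:
  assumes "rows V = rows W" "des_rows V = des_rows W" "connected_int K"
    and "\<forall>c\<in>V \<union> W. snd c \<le> b" "\<forall>c\<in>X. b < snd c"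
  shows "des_rows ({c \<in> V. fst c \<in> K} \<union> X) \<subseteq> des_rows ({c \<in> W. fst c \<in> K} \<union> X)"
proof (rule subrelI)
  let ?V = "{c \<in> V. fst c \<in> K} \<union> X" and ?W = "{c \<in> W. fst c \<in> K} \<union> X"
  fix i i' assume "(i, i') \<in> des_rows ?V"
  then obtain j j' where d: "i < i'" "(i, j) \<in> ?V" "(i', j') \<in> ?V" "j' < j"
    "\<forall>k\<in>rows ?V. \<not> (i < k \<and> k < i')"
    by (auto simp: des_rows_def)
  have mem: "k \<in> rows U \<longleftrightarrow> (\<exists>j. (k, j) \<in> U)" for U k
    by (force simp: rows_def)
  have "k \<in> rows ?V \<longleftrightarrow> k \<in> K \<and> k \<in> rows V \<or> k \<in> rows X" for k
    unfolding mem by auto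
  moreover have "k \<in> rows ?W \<longleftrightarrow> k \<in> K \<and> k \<in> rows W \<or> k \<in> rows X" for k
    unfolding mem by auto
  ultimately have rows: "rows ?V = rows ?W"
    using assms(1) by blast
  have "\<exists>j j'. (i, j) \<in> ?W \<and> (i', j') \<in> ?W \<and> j' < j"
  proof (cases "(i, j) \<in> X")
    case True
    show ?thesis
    proof (cases "(i', j') \<in> X")
      case False
      then have "i' \<in> rows W" "i' \<in> K"
        using d(3) assms(1) mem by auto
      then obtain k where "(i', k) \<in> W"
        by (auto simp: mem)
      moreover have "k < j"
        using bspec[OF assms(4), of "(i', k)"] bspec[OF assms(5), of "(i, j)"] True \<open>(i', k) \<in> W\<close> by simp
      ultimately show ?thesis
        using True \<open>i' \<in> K\<close> by auto
    qed (use True d in blast)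
  next
    case False
    then have V: "(i, j) \<in> V" "i \<in> K"
      using d(2) by auto
    then have "j' \<le> b"
      using bspec[OF assms(4), of "(i, j)"] d(4) by simp
    then have V': "(i', j') \<in> V" "i' \<in> K"
      using d(3) bspec[OF assms(5), of "(i', j')"] by auto
    \<comment> \<open>\<open>K\<close> is an interval, so every row between \<open>i\<close> and
      \<open>i'\<close> belongs to it: the two rows are consecutive in \<open>V\<close> as
      well.\<close>
    have "\<not> (i < k \<and> k < i')" if "k \<in> rows V" for k
    proof
      assume k: "i < k \<and> k < i'"
      then have "k \<in> K"
        using V(2) V'(2) connected_intD[OF assms(3), of i i' k] by simp
      then have "k \<in> rows ?V"
        using that by (auto simp: mem)
      then show False
        using k d(5) by blast
    qed
    then have "(i, i') \<in> des_rows V"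
      using V V' d(1,4) by (auto simp: des_rows_def)
    then have "(i, i') \<in> des_rows W"
      using assms(2) by simp
    then show ?thesis
      using V(2) V'(2) by (auto simp: des_rows_def)
  qed
  then show "(i, i') \<in> des_rows ?W"
    using d(1,5) rows by (simp add: des_rows_def)
qed

text \<open>\<open>i\<^sub>0\<close> is a shortest row among those meeting the leftmost column, and
  \<open>b\<close> is its right end; this makes \<open>H \<times> {a..b}\<close> the left
  rectangle.\<close>

locale left_step =
  fixes P :: "cell set" and H :: "int set" and a b i\<^sub>0 :: int
  assumes moon: "moon_polyomino P"
    and a: "a = Min (cols P)" and H: "H = col_of P a" and a_le_b: "a \<le> b"
    and shortest: "row_of P i\<^sub>0 = {a..b}"
    and interval_subset: "\<And>i. i \<in> H \<Longrightarrow> {a..b} \<subseteq> row_of P i"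
begin

definition rotate :: "cell set \<Rightarrow> cell set" where
  "rotate T = map_prod id (rotate_col a b) ` T"

definition step :: "cell set \<Rightarrow> cell set" where
  "step M = rotate (M - H \<times> {a..b}) \<union> tau (H \<times> {a..b}) (M \<inter> H \<times> {a..b})"

section \<open>The left rectangle and the rotated polyomino\<close>

lemma in_H_iff: "i \<in> H \<longleftrightarrow> a \<in> row_of P i"
  by (simp add: H col_of_def row_of_def)

lemma shortest_in_H: "i\<^sub>0 \<in> H"
  using a_le_b by (simp add: in_H_iff shortest)

lemma finite_P: "finite P"
  using moon by (simp add: moon_polyomino_def)

lemma finite_H: "finite H"
  by (simp add: H finite_col_of finite_P)

lemma connected_H: "connected_int H"
  by (simp add: H moon_connected_col moon)

lemma H_nonempty: "H \<noteq> {}"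
  using shortest_in_H by blast

lemma P_nonempty: "P \<noteq> {}"
  using shortest_in_H by (auto simp: H col_of_def)

lemma left_bound: "j \<in> row_of P i \<Longrightarrow> a \<le> j"
  unfolding a using row_of_subset_cols[of P i] finite_P by (intro Min_le) (auto simp: cols_def[of P])

lemma H_subset_rows: "H \<subseteq> rows P"
  by (auto simp: in_rows_iff in_H_iff)

text \<open>A row missing column \<open>a\<close> cannot contain row \<open>i\<^sub>0\<close>, so by
  nestedness it is contained in it. This is why a step merely shifts the rows outside
  \<open>H\<close>.\<close>

lemma row_outside_H:
  assumes "i \<notin> H"
  shows "row_of P i \<subseteq> {a<..b}"
proof -
  have "\<not> row_of P i\<^sub>0 \<subseteq> row_of P i"
    using assms shortest_in_H by (auto simp: in_H_iff)
  then have "row_of P i \<subseteq> {a..b}"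
    using moon_row_nested[OF moon, of i i\<^sub>0] shortest by auto
  moreover have "a \<notin> row_of P i"
    using assms by (simp add: in_H_iff)
  moreover have "{a..b} - {a} = {a<..b}"
    by auto
  ultimately show ?thesis
    by blast
qed

lemma interval_subset_cols: "{a..b} \<subseteq> cols P"
  using row_of_subset_cols shortest by blast

lemma cols_P: "cols P = {a..Max (cols P)}"
  using moon_cols[OF moon P_nonempty] a by simp

lemma box_subset: "H \<times> {a..b} \<subseteq> P"
  using interval_subset by (force simp: row_of_def)

text \<open>A competing rectangle contains \<open>(i\<^sub>0, a)\<close>: each of its columns meets
  row \<open>i\<^sub>0\<close> and each of its rows meets column \<open>a\<close>, inside
  \<open>P\<close>.\<close>

lemma left_rectangle_eq: "left_rectangle P = H \<times> {a..b}"
  unfolding left_rectangle_def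
proof (rule Greatest_equality)
  have "rectangle (H \<times> {a..b})"
    using a_le_b
    by (intro rectangle_box finite_H H_nonempty connected_H) (auto simp: connected_int_def)
  moreover have "{c \<in> P. snd c = Min (cols P)} \<subseteq> H \<times> {a..b}"
    using a_le_b by (auto simp: H a col_of_def)
  ultimately show "rectangle (H \<times> {a..b}) \<and> H \<times> {a..b} \<subseteq> P \<and>
      {c \<in> P. snd c = Min (cols P)} \<subseteq> H \<times> {a..b}"
    using box_subset by blast
next
  fix Q assume Q: "rectangle Q \<and> Q \<subseteq> P \<and> {c \<in> P. snd c = Min (cols P)} \<subseteq> Q"
  then obtain K J where KJ: "Q = K \<times> J"
    by (auto simp: rectangle_def)
  have "(i\<^sub>0, a) \<in> Q"
    using Q shortest_in_H by (auto simp: H a col_of_def)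
  show "Q \<subseteq> H \<times> {a..b}"
  proof (rule subrelI)
    fix i j assume "(i, j) \<in> Q"
    then have "(i, a) \<in> P" "(i\<^sub>0, j) \<in> P"
      using \<open>(i\<^sub>0, a) \<in> Q\<close> Q KJ by auto
    then show "(i, j) \<in> H \<times> {a..b}"
      using shortest by (auto simp: H col_of_def row_of_def)
  qed
qed

lemma move_col_eq: "move_col (H \<times> {a..b}) ` T = rotate T"
  by (simp add: rotate_def move_col_box[OF H_nonempty a_le_b])

lemma inj_rotate_col: "inj (rotate_col a b)"
  using bij_rotate_col[OF a_le_b] by (rule bij_is_inj)

lemma inj_rotate_cell: "inj (map_prod id (rotate_col a b) :: cell \<Rightarrow> cell)"
  using inj_rotate_col by (intro prod.inj_map) auto

lemma col_of_rotate: "col_of (rotate T) (rotate_col a b j) = col_of T j"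
  unfolding rotate_def by (rule col_of_map_prod[OF inj_rotate_col])

lemma row_of_rotate: "row_of (rotate T) i = rotate_col a b ` row_of T i"
  unfolding rotate_def by (rule row_of_map_prod)

lemma rows_rotate: "rows (rotate T) = rows T"
  unfolding rotate_def by (rule rows_map_prod)

lemma cols_rotate_P: "cols (rotate P) = cols P"
  unfolding rotate_def cols_map_prod by (rule rotate_col_image_superset[OF a_le_b interval_subset_cols])

lemma row_of_rotate_P:
  "row_of (rotate P) i = (if i \<in> H then row_of P i else (\<lambda>j. j - 1) ` row_of P i)"
  using rotate_col_image_superset[OF a_le_b interval_subset] rotate_col_image_subset[OF row_outside_H]
  by (simp add: row_of_rotate)

lemma rotate_Times: "rotate (K \<times> J) = K \<times> rotate_col a b ` J"
  unfolding rotate_def by (rule map_prod_surj_on) simp_all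

lemma rotate_box_fixed: "{a..b} \<subseteq> J \<Longrightarrow> rotate (K \<times> J) = K \<times> J"
  by (simp add: rotate_Times rotate_col_image_superset[OF a_le_b])

lemma rotate_box_shift: "J \<subseteq> {a<..b} \<Longrightarrow> rotate (K \<times> J) = K \<times> (\<lambda>j. j - 1) ` J"
  by (simp add: rotate_Times rotate_col_image_subset)

lemma rotate_Int: "rotate (T \<inter> U) = rotate T \<inter> rotate U"
  unfolding rotate_def by (rule image_Int[OF inj_rotate_cell])

text \<open>Columns are only permuted, and each row is fixed or translated by one.\<close>

lemma moon_rotate: "moon_polyomino (rotate P)"
proof -
  have col: "\<exists>j'. j = rotate_col a b j'" for j
    using bij_rotate_col[OF a_le_b] by (metis bij_pointE)
  have "connected_int (row_of (rotate P) i)" for i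
    using moon_connected_row[OF moon, of i] by (simp add: row_of_rotate_P connected_int_pred)
  moreover have "connected_int (col_of (rotate P) j)" for j
    using col[of j] moon_connected_col[OF moon] col_of_rotate by metis
  moreover have "intersection_free (rotate P)"
    unfolding intersection_free_def
  proof (intro ballI)
    fix j j' assume *: "j \<in> cols (rotate P)" "j' \<in> cols (rotate P)"
    obtain k k' where k: "j = rotate_col a b k" "j' = rotate_col a b k'"
      using col by metis
    with * have "k \<in> cols P" "k' \<in> cols P"
      by (auto simp: in_cols_iff col_of_rotate)
    then show "col_of (rotate P) j \<subseteq> col_of (rotate P) j' \<or> col_of (rotate P) j' \<subseteq> col_of (rotate P) j"
      using moon by (simp add: k col_of_rotate moon_polyomino_def intersection_free_def)
  qed
  moreover have "finite (rotate P)"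
    by (simp add: rotate_def finite_P)
  ultimately show ?thesis
    by (simp add: moon_polyomino_def convex_polyomino_def)
qed

lemma spanned_rect_rotate: "spanned_rect (rotate P) i = rotate (spanned_rect P i)"
proof -
  have "rotate_col a b ` row_of P i \<subseteq> rotate_col a b ` row_of P k \<longleftrightarrow> row_of P i \<subseteq> row_of P k" for k
    by (rule inj_image_subset_iff[OF inj_rotate_col])
  then show ?thesis
    unfolding spanned_rect_def row_of_rotate rotate_Times by simp
qed

lemma rect_list_sorted:
  shows "set (rect_list P) = maximal_rectangles P"
    and "sorted_wrt (<) (map (\<lambda>R. card (rows R)) (rect_list P))"
proof -
  have "finite (maximal_rectangles P)"
    using finite_P by (simp add: maximal_rectangles_moon[OF moon] rows_def)
  then show "set (rect_list P) = maximal_rectangles P"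
    and "sorted_wrt (<) (map (\<lambda>R. card (rows R)) (rect_list P))"
    unfolding rect_list_def
    using sorted_key_list_of_set_properties inj_on_height_maximal_rectangles[OF moon] by blast+
qed

text \<open>\<open>rotate\<close> carries spanned rectangles to spanned rectangles and keeps their
  rows, hence their heights and their order.\<close>

lemma rect_list_rotate: "rect_list (rotate P) = map rotate (rect_list P)"
  unfolding rect_list_def[of "rotate P"]
proof (rule sorted_key_list_of_set_eqI)
  show "sorted_wrt (<) (map (\<lambda>R. card (rows R)) (map rotate (rect_list P)))"
    using rect_list_sorted(2) by (simp add: o_def rows_rotate)
  show "set (map rotate (rect_list P)) = maximal_rectangles (rotate P)"
    using rect_list_sorted(1)
    by (simp add: maximal_rectangles_moon[OF moon] maximal_rectangles_moon[OF moon_rotate]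
        rows_rotate spanned_rect_rotate image_image)
qed

text \<open>A step preserves the descents in flat boxes and the words of tall ones.\<close>

definition flat :: "cell set \<Rightarrow> bool" where
  "flat Q \<longleftrightarrow> (\<exists>K J. Q = K \<times> J \<and> connected_int K \<and> connected_int J \<and>
     K \<subseteq> H \<and> {a..b} \<subseteq> J \<and> (\<forall>j\<in>J. a \<le> j))"

definition tall :: "cell set \<Rightarrow> bool" where
  "tall Q \<longleftrightarrow> (\<exists>K J. Q = K \<times> J \<and> connected_int K \<and> connected_int J \<and>
     H \<subseteq> K \<and> J \<subseteq> {a<..b})"

section \<open>The filling after a step and its major index on boxes\<close>

context
  fixes M assumes filling: "filling P M"
begin

abbreviation "W \<equiv> M \<inter> H \<times> {a..b}"
abbreviation "V \<equiv> tau (H \<times> {a..b}) W"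

lemma row_filling_M: "row_filling M"
  using filling finite_P by (rule filling_row_filling[rotated])

lemma row_filling_W: "row_filling W"
  using row_filling_M by (rule row_filling_subset) simp

lemmas V_props =
  row_filling_tau[OF connected_H H_nonempty a_le_b row_filling_W Int_lower2]
  rows_tau[OF connected_H H_nonempty a_le_b row_filling_W Int_lower2]
  word_tau[OF connected_H H_nonempty a_le_b row_filling_W Int_lower2]
  tau_subset[OF connected_H H_nonempty a_le_b row_filling_W Int_lower2]
  des_rows_tau[OF connected_H H_nonempty a_le_b row_filling_W Int_lower2]

lemma M_subset: "(i, j) \<in> M \<Longrightarrow> j \<in> row_of P i"
  using filling by (auto simp: filling_def row_of_def)

text \<open>In rows of \<open>H\<close>, whatever lies to the right of the box is fixed by the
  rotation; rows outside \<open>H\<close> stay within the columns \<open>a + 1..b\<close>, so their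
  cells come from one column further right.\<close>

lemma mem_step_iff:
  "(i, j) \<in> step M \<longleftrightarrow>
    (if i \<in> H then if j \<le> b then (i, j) \<in> V else (i, j) \<in> M else (i, j + 1) \<in> M)"
proof -
  have rot: "(i, j) \<in> rotate T \<longleftrightarrow> (\<exists>k. (i, k) \<in> T \<and> j = rotate_col a b k)" for T
    by (force simp: rotate_def)
  have V: "(i, j) \<in> V \<Longrightarrow> i \<in> H \<and> a \<le> j \<and> j \<le> b"
    using V_props(4) by auto
  show ?thesis
  proof (cases "i \<in> H")
    case True
    have "b < k \<and> rotate_col a b k = k" if "(i, k) \<in> M - H \<times> {a..b}" for k
    proof -
      have "a \<le> k"
        using that M_subset left_bound by blast
      then show ?thesis
        using that True a_le_b by (auto simp: rotate_col_def)
    qed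
    then have "(i, j) \<in> rotate (M - H \<times> {a..b}) \<longleftrightarrow> (i, j) \<in> M \<and> b < j"
      unfolding rot using True by (metis DiffD1 DiffI SigmaD2 atLeastAtMost_iff not_less)
    then show ?thesis
      using True V by (auto simp: step_def)
  next
    case False
    have "rotate_col a b k = k - 1" if "(i, k) \<in> M" for k
      using M_subset[OF that] row_outside_H[OF False] by (auto simp: rotate_col_def)
    then have "(i, j) \<in> rotate (M - H \<times> {a..b}) \<longleftrightarrow> (i, j + 1) \<in> M"
      unfolding rot using False by force
    then show ?thesis
      using False V by (auto simp: step_def)
  qed
qed

lemma step_subset: "step M \<subseteq> rotate P"
proof -
  have "rotate (M - H \<times> {a..b}) \<subseteq> rotate P"
    using filling by (auto simp: rotate_def filling_def)
  moreover have "V \<subseteq> rotate (H \<times> {a..b})"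
    using V_props(4) by (simp add: rotate_box_fixed)
  moreover have "rotate (H \<times> {a..b}) \<subseteq> rotate P"
    unfolding rotate_def by (rule image_mono[OF box_subset])
  ultimately show ?thesis
    unfolding step_def by blast
qed

lemma rows_V_disjoint: "i \<in> rows V \<Longrightarrow> (i, j) \<in> M \<Longrightarrow> j \<le> b"
proof -
  assume "i \<in> rows V" "(i, j) \<in> M"
  then obtain k where "(i, k) \<in> W"
    using V_props(2) by (auto simp: rows_def)
  then show "j \<le> b"
    using row_filling_unique[OF row_filling_M \<open>(i, j) \<in> M\<close>] by auto
qed

lemma filling_step: "filling (rotate P) (step M)"
  unfolding filling_def
proof (intro conjI allI impI)
  fix i j j' assume *: "(i, j) \<in> step M" "(i, j') \<in> step M"
  have "k \<le> b" if "(i, k) \<in> M" "(i, k') \<in> V" for k k'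
    using rows_V_disjoint[OF _ that(1)] that(2) by (force simp: rows_def)
  then show "j = j'"
    using * row_filling_unique[OF row_filling_M] row_filling_unique[OF V_props(1)]
    unfolding mem_step_iff by (auto split: if_splits) fastforce+
qed (rule step_subset)

lemma row_filling_step: "row_filling (step M)"
  using filling_step moon_rotate by (auto simp: moon_polyomino_def intro: filling_row_filling)

lemma rows_step: "rows (step M) = rows M"
proof -
  have mem: "k \<in> rows U \<longleftrightarrow> (\<exists>j. (k, j) \<in> U)" for U k
    by (force simp: rows_def)
  have V: "(\<exists>j. (k, j) \<in> V) \<longleftrightarrow> (\<exists>j. (k, j) \<in> W)" for k
    using V_props(2) mem by blast
  have le: "j \<le> b" if "(k, j) \<in> V" for k j
    using that V_props(4) by auto
  have "k \<in> rows (step M) \<longleftrightarrow> k \<in> rows M" for k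
  proof (cases "k \<in> H")
    case True
    then have "k \<in> rows (step M) \<longleftrightarrow> (\<exists>j. (k, j) \<in> V) \<or> (\<exists>j. (k, j) \<in> M \<and> b < j)"
      unfolding mem mem_step_iff using le by (metis not_le)
    also have "\<dots> \<longleftrightarrow> k \<in> rows M"
      unfolding V unfolding mem using True M_subset left_bound by (force simp: not_le)
    finally show ?thesis .
  next
    case False
    then show ?thesis
      unfolding mem mem_step_iff by simp (metis diff_add_cancel)
  qed
  then show ?thesis by blast
qed

text \<open>In the rows \<open>K\<close>, a flat box holds all of the left rectangle, together with
  cells \<open>X\<close> to the right of column \<open>b\<close>, which do not move.
  \<open>des_rows_union\<close>, used in both directions, transfers the descents.\<close>

lemma flat_same_des:
  assumes "connected_int K" "K \<subseteq> H" "{a..b} \<subseteq> J" "\<forall>j\<in>J. a \<le> j"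
  shows "same_des (word (M \<inter> K \<times> J)) (word (step M \<inter> K \<times> J))"
proof -
  define X where "X = {c \<in> M. fst c \<in> K \<and> snd c \<in> J \<and> b < snd c}"
  have KJ: "i \<in> K \<Longrightarrow> i \<in> H" "a \<le> j \<Longrightarrow> j \<le> b \<Longrightarrow> j \<in> J" "j \<in> J \<Longrightarrow> a \<le> j" for i j
    using assms by (auto simp: subset_iff)
  have VD: "i \<in> H" "a \<le> j" "j \<le> b" if "(i, j) \<in> V" for i j
    using that V_props(4) by auto
  have T: "M \<inter> K \<times> J = {c \<in> W. fst c \<in> K} \<union> X"
  proof (intro set_eqI, rename_tac c, case_tac c, hypsubst)
    fix i j
    show "(i, j) \<in> M \<inter> K \<times> J \<longleftrightarrow> (i, j) \<in> {c \<in> W. fst c \<in> K} \<union> X"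
      using KJ(1)[of i] KJ(2,3)[of j] by (cases "j \<le> b") (auto simp: X_def)
  qed
  have U: "step M \<inter> K \<times> J = {c \<in> V. fst c \<in> K} \<union> X"
  proof (intro set_eqI, rename_tac c, case_tac c, hypsubst)
    fix i j
    show "(i, j) \<in> step M \<inter> K \<times> J \<longleftrightarrow> (i, j) \<in> {c \<in> V. fst c \<in> K} \<union> X"
      using KJ(1)[of i] KJ(2,3)[of j] VD[of i j] by (cases "j \<le> b") (auto simp: X_def mem_step_iff)
  qed
  have "snd c \<le> b" if "c \<in> V \<union> W" for c
    using that VD(3)[of "fst c" "snd c"] by auto
  then have bounds: "\<forall>c\<in>V \<union> W. snd c \<le> b" "\<forall>c\<in>X. b < snd c"
    by (blast, simp add: X_def)
  have bounds': "\<forall>c\<in>W \<union> V. snd c \<le> b"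
    using bounds(1) by (simp only: Un_commute)
  have mem: "k \<in> rows U \<longleftrightarrow> (\<exists>j. (k, j) \<in> U)" for U k
    by (force simp: rows_def)
  have "rows ({c \<in> V. fst c \<in> K} \<union> X) = {k \<in> rows V. k \<in> K} \<union> rows X"
    "rows ({c \<in> W. fst c \<in> K} \<union> X) = {k \<in> rows W. k \<in> K} \<union> rows X"
    by (auto simp: mem)
  then have rows: "rows (M \<inter> K \<times> J) = rows (step M \<inter> K \<times> J)"
    unfolding T U V_props(2) by simp
  have des: "des_rows (M \<inter> K \<times> J) = des_rows (step M \<inter> K \<times> J)"
    unfolding T U
    by (intro equalityI des_rows_union[OF V_props(2,5) assms(1) bounds]
        des_rows_union[OF V_props(2,5)[symmetric] assms(1) bounds' bounds(2)])
  show ?thesis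
    by (subst same_des_word_iff[OF _ _ rows])
      (simp_all only: des row_filling_subset[OF row_filling_M Int_lower1]
        row_filling_subset[OF row_filling_step Int_lower1])
qed

text \<open>Above and below the rows of \<open>H\<close> the box is merely shifted; inside them, the columns of \<open>J\<close>
  avoid both letters that \<open>\<tau>\<close> moves.\<close>

lemma tall_word:
  assumes "H \<subseteq> K" "J \<subseteq> {a<..b}"
  shows "word (step M \<inter> K \<times> (\<lambda>j. j - 1) ` J) = map (\<lambda>j. j - 1) (word (M \<inter> K \<times> J))"
proof -
  let ?p = "map_prod id (\<lambda>j. j - 1) :: cell \<Rightarrow> cell"
  let ?J = "(\<lambda>j. j - 1) ` J"
  have J: "j \<in> ?J \<longleftrightarrow> j + 1 \<in> J" for j
    by force
  \<comment> \<open>\<open>H\<close> is an interval containing \<open>i\<^sub>0\<close>, so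
    comparison with \<open>i\<^sub>0\<close> tells whether a row outside \<open>H\<close> lies above
    or below all of \<open>H\<close>.\<close>
  define A where "A = {c \<in> M \<inter> K \<times> J. fst c \<notin> H \<and> fst c < i\<^sub>0}"
  define B where "B = {c \<in> W. snd c \<in> J}"
  define C where "C = {c \<in> M \<inter> K \<times> J. fst c \<notin> H \<and> i\<^sub>0 < fst c}"
  define B' where "B' = {c \<in> V. snd c + 1 \<in> J}"
  have sub: "A \<subseteq> M" "B \<subseteq> M" "C \<subseteq> M"
    by (auto simp: A_def B_def C_def)
  have rf: "row_filling A" "row_filling B" "row_filling C" "row_filling B'"
    using sub row_filling_subset[OF row_filling_M] row_filling_subset[OF V_props(1), of B']
    by (blast, blast, blast, simp add: B'_def subset_iff)
  have above: "fst c < k" if "c \<in> A" "k \<in> H" for c k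
  proof (rule ccontr)
    assume "\<not> fst c < k"
    moreover have "fst c \<notin> H" "fst c < i\<^sub>0"
      using that(1) by (simp_all add: A_def)
    ultimately show False
      using connected_intD[OF connected_H that(2) shortest_in_H, of "fst c"] by simp
  qed
  have below: "k < fst c" if "c \<in> C" "k \<in> H" for c k
  proof (rule ccontr)
    assume "\<not> k < fst c"
    moreover have "fst c \<notin> H" "i\<^sub>0 < fst c"
      using that(1) by (simp_all add: C_def)
    ultimately show False
      using connected_intD[OF connected_H shortest_in_H that(2), of "fst c"] by simp
  qed
  have AC: "fst c < fst d" if "c \<in> A" "d \<in> C" for c d
    using that by (simp add: A_def C_def)
  have side: "i \<in> H \<Longrightarrow> i \<in> K" "i \<notin> H \<Longrightarrow> i < i\<^sub>0 \<or> i\<^sub>0 < i" for i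
    using assms(1) shortest_in_H by (blast, cases i i\<^sub>0 rule: linorder_cases) auto
  have T: "M \<inter> K \<times> J = (A \<union> B) \<union> C"
  proof (intro set_eqI, rename_tac c, case_tac c, hypsubst)
    fix i j
    have "j \<in> J \<Longrightarrow> a \<le> j \<and> j \<le> b"
      using assms(2) by auto
    then show "(i, j) \<in> M \<inter> K \<times> J \<longleftrightarrow> (i, j) \<in> (A \<union> B) \<union> C"
      using side[of i] by (cases "i \<in> H") (auto simp: A_def B_def C_def)
  qed
  have U: "step M \<inter> K \<times> ?J = (?p ` A \<union> B') \<union> ?p ` C"
  proof (intro set_eqI, rename_tac c, case_tac c, hypsubst)
    fix i j
    have p: "(i, j) \<in> ?p ` Y \<longleftrightarrow> (i, j + 1) \<in> Y" for Y
      by (force simp: image_iff)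
    have j: "j + 1 \<in> J \<Longrightarrow> j \<le> b"
      using assms(2) by auto
    have VD: "(i, j) \<in> V \<Longrightarrow> i \<in> H"
      using V_props(4) by auto
    show "(i, j) \<in> step M \<inter> K \<times> ?J \<longleftrightarrow> (i, j) \<in> (?p ` A \<union> B') \<union> ?p ` C"
      unfolding Un_iff p using j VD side[of i]
      by (cases "i \<in> H") (auto simp: mem_step_iff A_def B'_def C_def J)
  qed
  have inH: "fst c \<in> H" if "c \<in> B \<union> B'" for c
    using that V_props(4) by (auto simp: B_def B'_def)
  have rfp: "row_filling (?p ` A)" "row_filling (?p ` C)"
    using word_pred(1) rf by blast+
  have fstp: "\<exists>d\<in>Y. fst c = fst d" if "c \<in> ?p ` Y" for c Y
  proof -
    have "fst c \<in> rows (?p ` Y)"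
      unfolding rows_def using that by (rule imageI)
    then show ?thesis
      unfolding rows_map_prod unfolding rows_def by (elim imageE) (rule bexI)
  qed
  have "ones (A \<union> B) = ones A @ ones B"
    by (rule ones_append[OF rf(1,2)]) (rule above, assumption, rule inH, blast)
  moreover have "ones (?p ` A \<union> B') = ones (?p ` A) @ ones B'"
  proof (rule ones_append[OF rfp(1) rf(4)])
    fix c d assume c: "c \<in> ?p ` A" and d: "d \<in> B'"
    obtain e where "e \<in> A" "fst c = fst e"
      using fstp[OF c] by (elim bexE)
    then show "fst c < fst d"
      using above[of e "fst d"] inH[of d] d by simp
  qed
  moreover have "ones ((A \<union> B) \<union> C) = ones (A \<union> B) @ ones C"
  proof (rule ones_append)
    show "row_filling (A \<union> B)"
      using row_filling_M by (rule row_filling_subset) (simp add: sub)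
    fix c d assume c: "c \<in> A \<union> B" and d: "d \<in> C"
    show "fst c < fst d"
      using c AC[of c d] below[OF d, of "fst c"] inH[of c] d by (elim UnE) simp_all
  qed (rule rf)
  moreover have "ones ((?p ` A \<union> B') \<union> ?p ` C) = ones (?p ` A \<union> B') @ ones (?p ` C)"
  proof (rule ones_append)
    show "row_filling (?p ` A \<union> B')"
    proof (rule row_filling_subset[OF row_filling_step])
      have "?p ` A \<union> B' \<subseteq> step M \<inter> K \<times> ?J"
        unfolding U by (rule Un_upper1)
      then show "?p ` A \<union> B' \<subseteq> step M"
        by (rule order_trans) (rule Int_lower1)
    qed
    fix c d assume c: "c \<in> ?p ` A \<union> B'" and d: "d \<in> ?p ` C"
    obtain e where e: "e \<in> C" "fst d = fst e"
      using fstp[OF d] by (elim bexE)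
    show "fst c < fst d"
      using c
    proof
      assume c: "c \<in> ?p ` A"
      obtain g where "g \<in> A" "fst c = fst g"
        using fstp[OF c] by (elim bexE)
      then show ?thesis
        using AC[of g e] e by simp
    next
      assume "c \<in> B'"
      then show ?thesis
        using below[OF e(1)] inH[of c] e(2) by simp
    qed
  qed (rule rfp)
  ultimately have words: "word (M \<inter> K \<times> J) = word A @ word B @ word C"
    "word (step M \<inter> K \<times> ?J) = word (?p ` A) @ word B' @ word (?p ` C)"
    unfolding T U word_def by (simp_all only: map_append append_assoc)
  have "word B = filter (\<lambda>j. j \<in> J) (word W)"
    unfolding word_def B_def ones_filter[OF row_filling_W] filter_map o_def by (rule refl)
  moreover have "word B' = filter (\<lambda>j. j + 1 \<in> J) (word V)"
    unfolding word_def B'_def ones_filter[OF V_props(1)] filter_map o_def by (rule refl)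
  moreover have "set (word W) \<subseteq> {a..b}"
    by (auto simp: set_word[OF row_filling_W] cols_def)
  moreover have "a \<notin> J" "b + 1 \<notin> J"
    using assms(2) by auto
  ultimately have "word B' = map (\<lambda>j. j - 1) (word B)"
    using tau_columns_properties(3)[OF a_le_b, of "word W" J] by (simp add: V_props(3))
  then show ?thesis
    unfolding words by (simp add: word_pred(2) rf)
qed

lemma maj_rect_step:
  assumes "flat Q \<or> tall Q"
  shows "maj_rect (rotate Q) (step M \<inter> rotate Q) = maj_rect Q (M \<inter> Q)"
  using assms
proof
  assume "flat Q"
  then obtain K J where *: "Q = K \<times> J" "connected_int K" "connected_int J" "K \<subseteq> H" "{a..b} \<subseteq> J"
    "\<forall>j\<in>J. a \<le> j"
    by (auto simp: flat_def)
  have "maj_rect (K \<times> J) (T \<inter> K \<times> J) = word_maj (word (T \<inter> K \<times> J))" if "row_filling T" for T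
    using that * by (intro maj_rect_box) (auto intro: row_filling_subset)
  then show ?thesis
    using word_maj_cong[OF flat_same_des[OF *(2,4-6)]] row_filling_M row_filling_step
    by (simp add: *(1) rotate_box_fixed[OF *(5)])
next
  assume "tall Q"
  then obtain K J where *: "Q = K \<times> J" "connected_int K" "connected_int J" "H \<subseteq> K" "J \<subseteq> {a<..b}"
    by (auto simp: tall_def)
  let ?J = "(\<lambda>j. j - 1) ` J"
  have "maj_rect (K \<times> J) (M \<inter> K \<times> J) = word_maj (word (M \<inter> K \<times> J))"
    using * row_filling_M by (intro maj_rect_box) (auto intro: row_filling_subset)
  moreover have "maj_rect (K \<times> ?J) (step M \<inter> K \<times> ?J) = word_maj (word (step M \<inter> K \<times> ?J))"
    using * row_filling_step by (intro maj_rect_box connected_int_pred) (auto intro: row_filling_subset)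
  moreover have "word_maj (word (step M \<inter> K \<times> ?J)) = word_maj (word (M \<inter> K \<times> J))"
    unfolding tall_word[OF *(4,5)] using word_maj_cong[OF same_des_map_pred] by simp
  ultimately show ?thesis
    by (simp add: *(1) rotate_box_shift[OF *(5)])
qed

end

section \<open>Flat and tall maximal rectangles and their intersections\<close>

lemma spanned_rect_flat:
  assumes "i \<in> H"
  shows "flat (spanned_rect P i)"
proof -
  have "{k. row_of P i \<subseteq> row_of P k} \<subseteq> H"
    using assms by (auto simp: in_H_iff)
  then show ?thesis
    unfolding flat_def spanned_rect_def
    using connected_spanning_rows[OF moon, of i] moon_connected_row[OF moon, of i]
      interval_subset[OF assms] left_bound[of _ i] by blast
qed

text \<open>Row \<open>i\<close> lies in the columns \<open>a + 1..b\<close> and hence in every row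
  of \<open>H\<close>, so all rows of \<open>H\<close> belong to the rectangle.\<close>

lemma spanned_rect_tall:
  assumes "i \<notin> H"
  shows "tall (spanned_rect P i)"
proof -
  have "row_of P i \<subseteq> row_of P h" if "h \<in> H" for h
    using row_outside_H[OF assms] interval_subset[OF that] by force
  then show ?thesis
    unfolding tall_def spanned_rect_def
    using connected_spanning_rows[OF moon, of i] moon_connected_row[OF moon, of i]
      row_outside_H[OF assms] by blast
qed

lemma flat_Int: "flat Q \<Longrightarrow> flat Q' \<Longrightarrow> flat (Q \<inter> Q')"
  unfolding flat_def
  by (elim exE conjE, rule exI, rule exI, rule conjI, simp only: Times_Int_Times)
    (auto intro: connected_int_Int)

lemma tall_Int: "tall Q \<Longrightarrow> tall Q' \<Longrightarrow> tall (Q \<inter> Q')"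
  unfolding tall_def
  by (elim exE conjE, rule exI, rule exI, rule conjI, simp only: Times_Int_Times)
    (auto intro: connected_int_Int)

text \<open>If the flat box lacked some row of \<open>H\<close>, the intersection could combine part
  of the rows of \<open>H\<close> with columns of \<open>{a<..b}\<close> only, a shape for which
  neither invariance is available.\<close>

lemma flat_tall_Int:
  assumes "flat Q" "tall Q'" "H \<subseteq> rows Q"
  shows "tall (Q \<inter> Q')"
proof -
  obtain K J where Q: "Q = K \<times> J" "connected_int K" "connected_int J"
    using assms(1) by (auto simp: flat_def)
  obtain K' J' where Q': "Q' = K' \<times> J'" "connected_int K'" "connected_int J'" "H \<subseteq> K'" "J' \<subseteq> {a<..b}"
    using assms(2) by (auto simp: tall_def)
  have "rows Q \<subseteq> K"
    unfolding Q(1) rows_def by auto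
  with assms(3) have "H \<subseteq> K"
    by (rule order_trans)
  show ?thesis
    unfolding tall_def
  proof (intro exI conjI)
    show "Q \<inter> Q' = (K \<inter> K') \<times> (J \<inter> J')"
      unfolding Q(1) Q'(1) by (rule Times_Int_Times)
    show "H \<subseteq> K \<inter> K'"
      using \<open>H \<subseteq> K\<close> Q'(4) by (rule Int_greatest)
    show "J \<inter> J' \<subseteq> {a<..b}"
      using Q'(5) by (rule le_infI2)
  qed (intro connected_int_Int Q Q')+
qed

lemma rows_flat: "flat Q \<Longrightarrow> rows Q \<subseteq> H"
  by (auto simp: flat_def rows_def)

lemma rows_tall: "tall Q \<Longrightarrow> Q \<noteq> {} \<Longrightarrow> H \<subseteq> rows Q"
  by (force simp: tall_def rows_def)

lemma box_maximal: "H \<times> {a..b} \<in> maximal_rectangles P"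
proof -
  have "{i. row_of P i\<^sub>0 \<subseteq> row_of P i} = H"
    unfolding shortest
  proof (intro equalityI subsetI CollectI)
    fix i assume "i \<in> {i. {a..b} \<subseteq> row_of P i}"
    moreover have "a \<in> {a..b}"
      using a_le_b by simp
    ultimately show "i \<in> H"
      unfolding in_H_iff by blast
  qed (rule subsetD[OF interval_subset])
  then have "spanned_rect P i\<^sub>0 = H \<times> {a..b}"
    by (simp add: spanned_rect_def shortest)
  then show ?thesis
    using maximal_rectangles_moon[OF moon] shortest_in_H H_subset_rows by blast
qed

lemma maximal_rectangle_kind:
  assumes "Q \<in> maximal_rectangles P"
  shows "flat Q \<or> tall Q" "Q \<noteq> {}" "finite (rows Q)"
proof -
  obtain i where i: "i \<in> rows P" "Q = spanned_rect P i"
    using assms maximal_rectangles_moon[OF moon] by blast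
  then show "flat Q \<or> tall Q"
    using spanned_rect_flat spanned_rect_tall by blast
  show "Q \<noteq> {}"
    using i by (auto simp: spanned_rect_def in_rows_iff)
  show "finite (rows Q)"
    using i finite_P spanned_rect_subset finite_subset unfolding rows_def by blast
qed

text \<open>The box \<open>H \<times> {a..b}\<close> is itself a maximal rectangle. It therefore separates the flat from the
  tall ones in the list, so that intersections of consecutive rectangles are flat or tall again.\<close>

lemma consecutive_Int_kind:
  assumes "Suc k < length (rect_list P)"
  shows "flat (rect_list P ! k \<inter> rect_list P ! Suc k) \<or> tall (rect_list P ! k \<inter> rect_list P ! Suc k)"
proof -
  let ?Q = "\<lambda>k. rect_list P ! k"
  let ?h = "\<lambda>k. card (rows (?Q k))"
  have mono: "?h p < ?h q" if "p < q" "q < length (rect_list P)" for p q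
    using sorted_wrt_nth_less[OF rect_list_sorted(2) that(1)] that by simp
  have max: "?Q p \<in> maximal_rectangles P" if "p < length (rect_list P)" for p
    using rect_list_sorted(1) nth_mem[OF that] by simp
  note kind = maximal_rectangle_kind[OF max]
  have k: "k < length (rect_list P)"
    using assms by simp
  show ?thesis
  proof (cases "flat (?Q k)")
    case flat: True
    show ?thesis
    proof (cases "flat (?Q (Suc k))")
      case True
      then show ?thesis using flat_Int[OF flat] by simp
    next
      case False
      then have tall: "tall (?Q (Suc k))"
        using kind(1)[OF assms] by blast
      have "H \<times> {a..b} \<in> set (rect_list P)"
        using box_maximal rect_list_sorted(1) by simp
      then obtain m where m: "m < length (rect_list P)" "?Q m = H \<times> {a..b}"
        unfolding in_set_conv_nth by blast
      have hm: "rows (?Q m) = H"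
        using m(2) a_le_b by (simp add: rows_cols_box)
      \<comment> \<open>Compare the position \<open>m\<close> of the left rectangle with
        \<open>k\<close>. It cannot come earlier, a flat rectangle being at most as high as
        \<open>H\<close>. If it came later, it would be entry \<open>Suc k\<close>, a tall rectangle
        being at least as high as \<open>H\<close>; but it is not tall, since it contains column
        \<open>a\<close>.\<close>
      have "H \<subseteq> rows (?Q k)"
      proof (cases m k rule: linorder_cases)
        case less
        then have "card H < card (rows (?Q k))"
          using mono[OF less k] hm by simp
        then show ?thesis
          using card_mono[OF finite_H rows_flat[OF flat]] by simp
      next
        case equal
        then show ?thesis using hm by simp
      next
        case greater
        have "card H \<le> ?h (Suc k)"
          using card_mono[OF kind(3)[OF assms] rows_tall[OF tall kind(2)[OF assms]]] .
        have "m = Suc k"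
        proof (rule ccontr)
          assume "m \<noteq> Suc k"
          then have "?h (Suc k) < ?h m"
            using mono[OF _ m(1)] greater by simp
          then show False
            using \<open>card H \<le> ?h (Suc k)\<close> hm by simp
        qed
        then have "tall (H \<times> {a..b})"
          using tall m(2) by simp
        then obtain K J where KJ: "H \<times> {a..b} = K \<times> J" "J \<subseteq> {a<..b}"
          unfolding tall_def by blast
        have "(i\<^sub>0, a) \<in> H \<times> {a..b}"
          using shortest_in_H a_le_b by simp
        then have "a \<in> J"
          unfolding KJ(1) by simp
        then show ?thesis
          using KJ(2) by auto
      qed
      then show ?thesis
        using flat_tall_Int[OF flat tall] by blast
    qed
  next
    case False
    then have tall: "tall (?Q k)"
      using kind(1)[OF k] by blast
    show ?thesis
    proof (cases "flat (?Q (Suc k))")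
      case True
      \<comment> \<open>Tall before flat is impossible: heights increase along the list, while flat
        rectangles have at most and tall ones at least \<open>card H\<close> rows.\<close>
      have "?h (Suc k) \<le> card H"
        using card_mono[OF finite_H rows_flat[OF True]] .
      moreover have "card H \<le> ?h k"
        using card_mono[OF kind(3)[OF k] rows_tall[OF tall kind(2)[OF k]]] .
      ultimately show ?thesis
        using mono[OF lessI assms] by simp
    next
      case False
      then show ?thesis
        using tall_Int[OF tall] kind(1)[OF assms] by blast
    qed
  qed
qed

lemma maj_step:
  assumes "filling P M"
  shows "maj (rotate P) (step M) = maj P M"
proof -
  let ?Rs = "rect_list P"
  have max: "?Rs ! k \<in> maximal_rectangles P" if "k < length ?Rs" for k
    using rect_list_sorted(1) nth_mem[OF that] by simp
  have rects: "(\<Sum>k<length ?Rs. int (maj_rect (rotate (?Rs ! k)) (step M \<inter> rotate (?Rs ! k)))) =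
      (\<Sum>k<length ?Rs. int (maj_rect (?Rs ! k) (M \<inter> ?Rs ! k)))"
    using maj_rect_step[OF assms] maximal_rectangle_kind(1)[OF max] by simp
  have ints: "(\<Sum>k<length ?Rs - 1. int (maj_rect (rotate (?Rs ! k \<inter> ?Rs ! Suc k))
        (step M \<inter> rotate (?Rs ! k \<inter> ?Rs ! Suc k)))) =
      (\<Sum>k<length ?Rs - 1. int (maj_rect (?Rs ! k \<inter> ?Rs ! Suc k) (M \<inter> (?Rs ! k \<inter> ?Rs ! Suc k))))"
    using maj_rect_step[OF assms] consecutive_Int_kind by simp
  have "(\<Sum>k<length ?Rs. int (maj_rect (map rotate ?Rs ! k) (step M \<inter> map rotate ?Rs ! k))) =
      (\<Sum>k<length ?Rs. int (maj_rect (rotate (?Rs ! k)) (step M \<inter> rotate (?Rs ! k))))"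
    by (rule sum.cong) simp_all
  moreover have "(\<Sum>k<length ?Rs - 1. int (maj_rect (map rotate ?Rs ! k \<inter> map rotate ?Rs ! Suc k)
        (step M \<inter> (map rotate ?Rs ! k \<inter> map rotate ?Rs ! Suc k)))) =
      (\<Sum>k<length ?Rs - 1. int (maj_rect (rotate (?Rs ! k \<inter> ?Rs ! Suc k))
        (step M \<inter> rotate (?Rs ! k \<inter> ?Rs ! Suc k))))"
    by (rule sum.cong) (simp_all add: rotate_Int)
  ultimately show ?thesis
    unfolding maj_def Let_def rect_list_rotate length_map rects ints by (rule arg_cong2)
qed

section \<open>Column counts and bijectivity of a step\<close>

definition rotate_counts :: "nat list \<Rightarrow> nat list" where
  "rotate_counts s = rotate1 (take (card {a..b}) s) @ drop (card {a..b}) s"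

lemma length_rotate_counts [simp]: "length (rotate_counts s) = length s"
  by (simp add: rotate_counts_def)

text \<open>Column \<open>j\<close> has index \<open>j - a\<close> in the list of counts, since the
  columns form an interval; \<open>rotate_counts\<close> is the action of \<open>rotate_col\<close>
  on these indices.\<close>

lemma nth_rotate_counts:
  assumes "length s = card (cols P)" "j \<in> cols P"
  shows "rotate_counts s ! nat (rotate_col a b j - a) = s ! nat (j - a)"
proof -
  let ?n = "card {a..b}"
  have n: "?n = nat (b - a) + 1"
    using a_le_b by simp
  have "finite (cols P)"
    using finite_P by (simp add: cols_def)
  then have len: "?n \<le> length s"
    unfolding assms(1) using interval_subset_cols by (rule card_mono)
  have "a \<le> j"
    using assms(2) cols_P by auto
  consider "j = a" | "a < j" "j \<le> b" | "b < j"
    using \<open>a \<le> j\<close> by linarith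
  then show ?thesis
  proof cases
    case 1
    then show ?thesis
      using n len a_le_b by (simp add: rotate_counts_def rotate_col_def nth_append nth_rotate1)
  next
    case 2
    define k where "k = nat (j - 1 - a)"
    have k: "k < nat (b - a)" "nat (j - a) = Suc k" "rotate_col a b j = j - 1"
      using 2 by (auto simp: k_def rotate_col_def)
    have "rotate_counts s ! k = s ! Suc k"
      using k(1) n len by (simp add: rotate_counts_def nth_append nth_rotate1 del: card_atLeastAtMost_int)
    then show ?thesis
      unfolding k(2,3) k_def[symmetric] .
  next
    case 3
    then have "\<not> nat (j - a) < ?n" "rotate_col a b j = j"
      using n a_le_b by (auto simp: rotate_col_def)
    then show ?thesis
      using len by (simp add: rotate_counts_def nth_append del: card_atLeastAtMost_int)
  qed
qed

end

lemma nth_sorted_list_interval: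
  fixes c d :: int
  assumes "k < card {c..d}"
  shows "sorted_list_of_set {c..d} ! k = c + int k"
proof -
  have "sorted_list_of_set {c..d} = [c..d]"
    by (simp add: sorted_list_of_set.idem_if_sorted_distinct[of "[c..d]", simplified])
  then show ?thesis
    using assms by (simp add: nth_upto)
qed

lemma fillings_iff:
  assumes "moon_polyomino P" "P \<noteq> {}"
  shows "M \<in> fillings P s A \<longleftrightarrow> filling P M \<and> {i \<in> rows P. row_of M i = {}} = A \<and>
    (\<forall>j\<in>cols P. card (col_of M j) = s ! nat (j - Min (cols P)))"
proof -
  let ?c = "Min (cols P)" and ?d = "Max (cols P)"
  have cols: "cols P = {?c..?d}"
    by (rule moon_cols[OF assms])
  have "(\<forall>k<card (cols P). card (col_of M (sorted_list_of_set (cols P) ! k)) = s ! k) \<longleftrightarrow>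
    (\<forall>j\<in>cols P. card (col_of M j) = s ! nat (j - ?c))" (is "?L \<longleftrightarrow> ?R")
  proof
    assume L: ?L
    show ?R
    proof
      fix j assume j: "j \<in> cols P"
      then have "?c \<le> j" "j \<le> ?d"
        using cols by (metis atLeastAtMost_iff)+
      then have k: "nat (j - ?c) < card {?c..?d}"
        by simp
      then show "card (col_of M j) = s ! nat (j - ?c)"
        using L[rule_format, of "nat (j - ?c)"] nth_sorted_list_interval[OF k] cols \<open>?c \<le> j\<close> by simp
    qed
  next
    assume R: ?R
    show ?L
    proof (intro allI impI)
      fix k assume "k < card (cols P)"
      then have k: "k < card {?c..?d}"
        using cols by simp
      then have "?c + int k \<in> cols P"
        by (subst cols) simp
      then show "card (col_of M (sorted_list_of_set (cols P) ! k)) = s ! k"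
        using R nth_sorted_list_interval[OF k] cols by simp
    qed
  qed
  then show ?thesis
    by (simp add: fillings_def)
qed

context left_step
begin

lemma Min_cols_rotate: "Min (cols (rotate P)) = a"
  unfolding cols_rotate_P by (rule a[symmetric])

lemma rotate_cols_image: "cols P = rotate_col a b ` cols P"
  using rotate_col_image_superset[OF a_le_b interval_subset_cols] by simp

lemma rotate_nonempty: "rotate P \<noteq> {}"
  using P_nonempty by (simp add: rotate_def)

text \<open>\<open>M'\<close> is left open so that the statement covers both \<open>rotate M\<close>
  and \<open>step M\<close>.\<close>

lemma rotate_counts_iff:
  assumes "length s = card (cols P)" and "\<And>j. j \<in> cols P \<Longrightarrow> card (col_of M' (rotate_col a b j)) = card (col_of M j)"
  shows "(\<forall>j\<in>cols (rotate P). card (col_of M' j) = rotate_counts s ! nat (j - Min (cols (rotate P)))) \<longleftrightarrow>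
    (\<forall>j\<in>cols P. card (col_of M j) = s ! nat (j - Min (cols P)))"
proof -
  have "(\<forall>j\<in>cols (rotate P). card (col_of M' j) = rotate_counts s ! nat (j - a)) \<longleftrightarrow>
    (\<forall>j\<in>cols P. card (col_of M' (rotate_col a b j)) = rotate_counts s ! nat (rotate_col a b j - a))"
    unfolding cols_rotate_P by (subst rotate_cols_image) simp
  then show ?thesis
    using assms(2) nth_rotate_counts[OF assms(1)] unfolding Min_cols_rotate a[symmetric] by simp
qed

lemma rotate_filling_iff: "filling (rotate P) (rotate M) \<longleftrightarrow> filling P M"
proof -
  have uniq: "(\<forall>i j j'. (i, j) \<in> T \<longrightarrow> (i, j') \<in> T \<longrightarrow> j = j') \<longleftrightarrow>
      (\<forall>i. \<forall>j\<in>row_of T i. \<forall>j'\<in>row_of T i. j = j')" for T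
    by (auto simp: row_of_def)
  have "rotate M \<subseteq> rotate P \<longleftrightarrow> M \<subseteq> P"
    unfolding rotate_def by (rule inj_image_subset_iff[OF inj_rotate_cell])
  then show ?thesis
    unfolding filling_def uniq row_of_rotate by (simp add: inj_eq[OF inj_rotate_col])
qed

lemma rotate_fillings_iff:
  assumes "length s = card (cols P)"
  shows "rotate M \<in> fillings (rotate P) (rotate_counts s) A \<longleftrightarrow> M \<in> fillings P s A"
  unfolding fillings_iff[OF moon P_nonempty] fillings_iff[OF moon_rotate rotate_nonempty]
  using rotate_counts_iff[OF assms, of "rotate M" M]
  by (simp add: rotate_filling_iff rows_rotate row_of_rotate col_of_rotate)

text \<open>Outside \<open>H\<close> cells are only shifted; inside the left rectangle the counts
  are those of the word. Column \<open>a\<close> lies entirely in \<open>H\<close> and becomes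
  column \<open>b\<close>, to which rows outside \<open>H\<close> contribute nothing, since they
  ended at \<open>b\<close> or earlier before the shift.\<close>

lemma card_col_of_step:
  assumes "filling P M"
  shows "card (col_of (step M) (rotate_col a b j)) = card (col_of M j)"
proof -
  let ?W = "M \<inter> H \<times> {a..b}"
  let ?V = "tau (H \<times> {a..b}) ?W"
  note mem = mem_step_iff[OF assms] and V = V_props[OF assms]
  have V_sub: "i \<in> H" "a \<le> j" "j \<le> b" if "(i, j) \<in> ?V" for i j
    using V(4) that by auto
  have M: "i \<in> H \<or> a < j \<and> j \<le> b" "a \<le> j" if "(i, j) \<in> M" for i j
  proof -
    have j: "j \<in> row_of P i"
      using M_subset[OF assms that] .
    show "i \<in> H \<or> a < j \<and> j \<le> b"
      using subsetD[OF row_outside_H j] by (cases "i \<in> H") simp_all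
    show "a \<le> j"
      using j by (rule left_bound)
  qed
  have W: "set (word ?W) \<subseteq> {a..b}"
    by (auto simp: set_word[OF row_filling_W[OF assms]] cols_def)
  note tc = tau_columns_properties(4,5)[OF a_le_b W]
  have count: "card (col_of ?V k) = count_list (tau_columns a b (word ?W)) k"
    "card (col_of ?W k) = count_list (word ?W) k" for k
    using count_list_word[OF V(1)] count_list_word[OF row_filling_W[OF assms]] by (simp_all add: V(3))
  have fin: "finite (col_of T k)" if "row_filling T" for T k
    using that by (simp add: row_filling_def finite_col_of)
  have S: "i \<in> col_of (step M) k \<longleftrightarrow>
      (if i \<in> H then if k \<le> b then (i, k) \<in> ?V else (i, k) \<in> M else (i, k + 1) \<in> M)" for i k
    unfolding col_of_def mem_Collect_eq by (rule mem)
  have C: "i \<in> col_of T k \<longleftrightarrow> (i, k) \<in> T" for i k T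
    by (simp add: col_of_def)
  let ?O = "{i. i \<notin> H \<and> (i, j) \<in> M}"
  consider "j < a" | "j = a" | "a < j" "j \<le> b" | "b < j"
    by linarith
  then show ?thesis
  proof cases
    case 1
    then have "rotate_col a b j = j"
      using a_le_b by (simp add: rotate_col_def)
    moreover have "i \<notin> col_of M j" for i
      unfolding C using M(2)[of i j] 1 by auto
    moreover have "i \<notin> col_of (step M) j" for i
      unfolding S using 1 V_sub(2)[of i j] M[of i j] M(1)[of i "j + 1"] a_le_b by auto
    ultimately show ?thesis
      by (metis equals0I)
  next
    case 2
    then have r: "rotate_col a b j = b"
      by (simp add: rotate_col_def)
    have "i \<in> col_of (step M) b \<longleftrightarrow> i \<in> col_of ?V b" for i
      unfolding S unfolding C using V_sub(1)[of i b] M(1)[of i "b + 1"] by auto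
    then have "col_of (step M) b = col_of ?V b"
      by blast
    moreover have "i \<in> col_of M j \<longleftrightarrow> i \<in> col_of ?W a" for i
      unfolding C using 2 M(1)[of i j] a_le_b by auto
    then have "col_of M j = col_of ?W a"
      by blast
    ultimately show ?thesis
      using count tc(1) r by simp
  next
    case 3
    then have r: "rotate_col a b j = j - 1"
      by (simp add: rotate_col_def)
    have "i \<in> col_of (step M) (j - 1) \<longleftrightarrow> i \<in> col_of ?V (j - 1) \<union> ?O" for i
      unfolding Un_iff S unfolding C using 3 V_sub(1)[of i "j - 1"] by auto
    then have "col_of (step M) (j - 1) = col_of ?V (j - 1) \<union> ?O"
      by blast
    moreover have "i \<in> col_of M j \<longleftrightarrow> i \<in> col_of ?W j \<union> ?O" for i
      unfolding Un_iff C using 3 by auto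
    then have "col_of M j = col_of ?W j \<union> ?O"
      by blast
    moreover have "i \<in> col_of ?V (j - 1) \<longrightarrow> i \<notin> ?O" "i \<in> col_of ?W j \<longrightarrow> i \<notin> ?O" for i
      unfolding C using V_sub(1)[of i "j - 1"] by auto
    then have "col_of ?V (j - 1) \<inter> ?O = {}" "col_of ?W j \<inter> ?O = {}"
      by blast+
    moreover have "finite ?O"
      by (rule finite_subset[OF _ fin[OF row_filling_M[OF assms], of j]]) (auto simp: C)
    moreover have "card (col_of ?V (j - 1)) = card (col_of ?W j)"
      using count tc(2)[of "j - 1"] 3 by simp
    ultimately show ?thesis
      using r fin[OF V(1)] fin[OF row_filling_W[OF assms]] by (simp only: card_Un_disjoint)
  next
    case 4
    then have "rotate_col a b j = j"
      using a_le_b by (simp add: rotate_col_def)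
    moreover have "i \<in> col_of (step M) j \<longleftrightarrow> i \<in> col_of M j" for i
      unfolding S unfolding C using 4 M(1)[of i j] M(1)[of i "j + 1"] by auto
    then have "col_of (step M) j = col_of M j"
      by blast
    ultimately show ?thesis by simp
  qed
qed

lemma step_in_fillings:
  assumes "length s = card (cols P)" "M \<in> fillings P s A"
  shows "step M \<in> fillings (rotate P) (rotate_counts s) A"
proof -
  have M: "filling P M"
    using assms(2) by (simp add: fillings_def)
  have "row_of (step M) i = {} \<longleftrightarrow> row_of M i = {}" for i
    using rows_step[OF M] in_rows_iff by blast
  then show ?thesis
    using assms(2) filling_step[OF M] rotate_counts_iff[OF assms(1) card_col_of_step[OF M]]
    unfolding fillings_iff[OF moon P_nonempty] fillings_iff[OF moon_rotate rotate_nonempty]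
    by (simp add: rows_rotate)
qed

text \<open>The rotation maps the left rectangle onto itself, so the images of the cells inside and
  outside it can be told apart. Inside, \<open>tau_inj\<close> applies because \<open>s\<close>
  prescribes the number of 1's in column \<open>a\<close>.\<close>

lemma step_inj:
  assumes "M \<in> fillings P s A" "M' \<in> fillings P s A" "step M = step M'"
  shows "M = M'"
proof -
  let ?R = "H \<times> {a..b}"
  have fill: "filling P M" "filling P M'"
    using assms by (simp_all add: fillings_def)
  have disj: "rotate (T - ?R) \<inter> ?R = {}" for T
  proof -
    have "(T - ?R) \<inter> ?R = {}"
      by blast
    then have "rotate (T - ?R) \<inter> rotate ?R = {}"
      unfolding rotate_Int[symmetric] by (simp add: rotate_def)
    then show ?thesis
      by (simp add: rotate_box_fixed)
  qed
  have split: "step T \<inter> ?R = tau ?R (T \<inter> ?R)" "step T - ?R = rotate (T - ?R)" if "filling P T" for T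
    using disj[of T] V_props(4)[OF that] unfolding step_def by blast+
  have col: "col_of (T \<inter> ?R) a = col_of T a" if "filling P T" for T
  proof -
    have "i \<in> H" if "(i, a) \<in> T" for i
      using M_subset[OF \<open>filling P T\<close> that] by (simp add: in_H_iff)
    then show ?thesis
      using a_le_b by (auto simp: col_of_def)
  qed
  have "a \<in> cols P"
    using interval_subset_cols a_le_b by auto
  then have "card (col_of M a) = card (col_of M' a)"
    using assms(1,2) unfolding fillings_iff[OF moon P_nonempty] by simp
  then have "card (col_of (M \<inter> ?R) a) = card (col_of (M' \<inter> ?R) a)"
    by (simp only: col[OF fill(1)] col[OF fill(2)])
  moreover have "tau ?R (M \<inter> ?R) = tau ?R (M' \<inter> ?R)"
    using split(1)[OF fill(1)] split(1)[OF fill(2)] assms(3) by simp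
  ultimately have "M \<inter> ?R = M' \<inter> ?R"
    by (rule tau_inj[OF connected_H H_nonempty a_le_b row_filling_W[OF fill(1)] Int_lower2
          row_filling_W[OF fill(2)] Int_lower2])
  moreover have "rotate (M - ?R) = rotate (M' - ?R)"
    using split(2)[OF fill(1)] split(2)[OF fill(2)] assms(3) by simp
  then have "M - ?R = M' - ?R"
    unfolding rotate_def inj_image_eq_iff[OF inj_rotate_cell] .
  ultimately show ?thesis
    by blast
qed

lemma bij_betw_step:
  assumes "length s = card (cols P)"
  shows "bij_betw step (fillings P s A) (fillings (rotate P) (rotate_counts s) A)"
proof -
  let ?F = "fillings P s A" and ?G = "fillings (rotate P) (rotate_counts s) A"
  have inj: "inj_on step ?F"
    using step_inj by (rule inj_onI)
  have sub: "step ` ?F \<subseteq> ?G"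
    using step_in_fillings[OF assms] by blast
  have "?F \<subseteq> Pow P"
    by (auto simp: fillings_def filling_def)
  then have "finite ?F"
    using finite_P finite_subset by blast
  have "?G \<subseteq> rotate ` ?F"
  proof
    fix N assume N: "N \<in> ?G"
    then have "N \<subseteq> rotate P"
      by (simp add: fillings_def filling_def)
    then obtain M where "N = rotate M"
      unfolding rotate_def by (meson subset_imageE)
    then show "N \<in> rotate ` ?F"
      using N rotate_fillings_iff[OF assms] by blast
  qed
  then have "finite ?G" "card ?G \<le> card ?F"
    using \<open>finite ?F\<close> finite_surj[of ?F ?G rotate] surj_card_le[of ?F ?G rotate] by blast+
  then have "step ` ?F = ?G"
    using card_seteq[OF _ sub] card_image[OF inj] by simp
  with inj show ?thesis
    by (simp add: bij_betw_def)
qed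

end

section \<open>Existence of a step, termination and iteration\<close>

lemma left_step_exists:
  assumes "moon_polyomino P" "P \<noteq> {}"
  obtains H a b i\<^sub>0 where "left_step P H a b i\<^sub>0"
proof -
  let ?a = "Min (cols P)"
  let ?H = "col_of P ?a"
  have fin: "finite P" "finite (cols P)" "cols P \<noteq> {}"
    using assms by (auto simp: cols_def moon_polyomino_def)
  then have "?a \<in> cols P"
    by simp
  then have "?H \<noteq> {}"
    by (simp add: in_cols_iff)
  \<comment> \<open>The shortest row through the leftmost column determines the width of the left
    rectangle.\<close>
  then obtain i where i: "i \<in> ?H" "\<And>i'. i' \<in> ?H \<Longrightarrow> row_of P i \<subseteq> row_of P i'"
    using shortest_row[OF assms(1) finite_col_of[OF fin(1)]] by blast
  have a: "?a \<in> row_of P i"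
    using i(1) by (simp add: col_of_def row_of_def)
  have "\<And>j. j \<in> row_of P i \<Longrightarrow> ?a \<le> j"
    using Min_le[OF fin(2)] row_of_subset_cols by blast
  then have "Min (row_of P i) = ?a"
    using a finite_row_of[OF fin(1)] by (intro Min_eqI)
  then have row: "row_of P i = {?a..Max (row_of P i)}"
    using finite_connected_int[OF finite_row_of[OF fin(1)] _ moon_connected_row[OF assms(1)]] a by force
  show thesis
  proof (rule that, unfold_locales)
    show "row_of P i = {?a..Max (row_of P i)}"
      by (rule row)
    show "?a \<le> Max (row_of P i)"
      using a finite_row_of[OF fin(1)] by simp
    show "{?a..Max (row_of P i)} \<subseteq> row_of P k" if "k \<in> ?H" for k
      using i(2)[OF that] row by simp
  qed (use assms in simp_all)
qed

lemma alpha_unfold: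
  "alpha (P, s) = (if left_aligned P then (P, s) else alpha (alpha_step (P, s)))"
  unfolding alpha_def by (subst while_unfold) simp

lemma f_map_unfold:
  "f_map P M = (if left_aligned P then M else f_map (fst (f_step (P, M))) (snd (f_step (P, M))))"
  unfolding f_map_def by (subst while_unfold) simp

text \<open>Termination measure: the total distance of the rows from the left edge. A step reduces
  it by one for each row outside \<open>H\<close>, and the rows of \<open>H\<close> start at the
  left edge already.\<close>

definition indentation :: "cell set \<Rightarrow> nat" where
  "indentation P = (\<Sum>i\<in>rows P. nat (Min (row_of P i) - Min (cols P)))"

context left_step
begin

lemma alpha_step_eq: "alpha_step (P, s) = (rotate P, rotate_counts s)"
  by (simp add: alpha_step_def left_rectangle_eq move_col_eq rotate_counts_def Let_def
      rows_cols_box H_nonempty)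

lemma f_step_eq: "f_step (P, M) = (rotate P, step M)"
  by (simp add: f_step_def left_rectangle_eq move_col_eq step_def Let_def)

lemma indentation_rotate:
  assumes "\<not> left_aligned P"
  shows "indentation (rotate P) < indentation P"
proof -
  let ?f = "\<lambda>i. nat (Min (row_of (rotate P) i) - a)" and ?g = "\<lambda>i. nat (Min (row_of P i) - a)"
  have less: "?f i < ?g i" if "i \<in> rows P" "i \<notin> H" for i
  proof -
    have row: "finite (row_of P i)" "row_of P i \<noteq> {}"
      using that(1) finite_P by (simp_all add: finite_row_of in_rows_iff)
    then have "Min ((\<lambda>j. j - 1) ` row_of P i) = Min (row_of P i) - 1"
      using mono_Min_commute[of "\<lambda>j. j - 1 :: int"] by (simp add: mono_def)
    moreover have "a < Min (row_of P i)"
      using row row_outside_H[OF that(2)] Min_in by fastforce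
    ultimately show ?thesis
      using that(2) by (simp add: row_of_rotate_P)
  qed
  have "?f i \<le> ?g i" if "i \<in> rows P" for i
  proof (cases "i \<in> H")
    case False
    then show ?thesis
      by (rule less_imp_le[OF less[OF that]])
  qed (simp add: row_of_rotate_P)
  moreover obtain i where "i \<in> rows P" "i \<notin> H"
    using assms by (auto simp: left_aligned_def a[symmetric] in_H_iff row_of_def)
  moreover have "finite (rows P)"
    using finite_P by (simp add: rows_def)
  ultimately have "(\<Sum>i\<in>rows P. ?f i) < (\<Sum>i\<in>rows P. ?g i)"
    using less by (intro sum_strict_mono_ex1) auto
  then show ?thesis
    unfolding indentation_def rows_rotate Min_cols_rotate a[symmetric] .
qed

end

theorem proposition5p9:
  fixes P :: "cell set" and m :: nat and s :: "nat list" and A :: "int set"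
    and N :: "cell set" and s' :: "nat list"
  assumes "moon_polyomino P"
    and "card (cols P) = m"
    and "length s = m"
    and "A \<subseteq> rows P"
    and "alpha (P, s) = (N, s')"
  shows "bij_betw (f_map P) (fillings P s A) (fillings N s' A) \<and>
         (\<forall>M\<in>fillings P s A. maj P M = maj N (f_map P M))"
proof -
  have "length s = card (cols P)"
    using assms by simp
  with assms(1,5) show ?thesis
  \<comment> \<open>\<open>alpha\<close> and \<open>f_map\<close> are unrolled at their first step,
    so \<open>P\<close> and \<open>s\<close> vary while \<open>N\<close>, \<open>s'\<close> and
    \<open>A\<close> stay fixed.\<close>
  proof (induction "indentation P" arbitrary: P s rule: less_induct)
    case less
    show ?case
    proof (cases "left_aligned P")
      case True
      then have "N = P" "s' = s"
        using less.prems(2) by (simp_all add: alpha_unfold[of P])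
      moreover have "f_map P = (\<lambda>M. M)"
        using True by (simp add: f_map_unfold[of P] fun_eq_iff)
      ultimately show ?thesis
        by (simp add: bij_betw_def)
    next
      case False
      \<comment> \<open>The empty polyomino is vacuously left-aligned.\<close>
      then have "P \<noteq> {}"
        by (auto simp: left_aligned_def rows_def)
      then obtain H a b i\<^sub>0 where "left_step P H a b i\<^sub>0"
        using left_step_exists less.prems(1) by blast
      then interpret left_step P H a b i\<^sub>0 .
      have f_map: "f_map P = f_map (rotate P) \<circ> step"
        using False by (auto simp: f_map_unfold[of P] f_step_eq)
      have "alpha (rotate P, rotate_counts s) = (N, s')"
        using less.prems(2) False by (simp add: alpha_unfold[of P] alpha_step_eq)
      moreover have "length (rotate_counts s) = card (cols (rotate P))"
        using less.prems(3) by (simp add: cols_rotate_P)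
      ultimately have IH: "bij_betw (f_map (rotate P)) (fillings (rotate P) (rotate_counts s) A) (fillings N s' A)"
        "\<forall>M\<in>fillings (rotate P) (rotate_counts s) A. maj (rotate P) M = maj N (f_map (rotate P) M)"
        using less.hyps[OF indentation_rotate[OF False] moon_rotate] by blast+
      have step: "bij_betw step (fillings P s A) (fillings (rotate P) (rotate_counts s) A)"
        using less.prems(3) by (rule bij_betw_step)
      have "maj P M = maj N (f_map P M)" if "M \<in> fillings P s A" for M
      proof -
        have "step M \<in> fillings (rotate P) (rotate_counts s) A"
          using step_in_fillings[OF less.prems(3) that] .
        moreover have "maj (rotate P) (step M) = maj P M"
          using that by (intro maj_step) (simp add: fillings_def)
        ultimately show ?thesis
          using IH(2) by (simp add: f_map)
      qed
      then show ?thesis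
        using bij_betw_trans[OF step IH(1)] f_map by simp
    qed
  qed
qed

end
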